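(* Simplification is a monad $\mathrm{si}_\bullet=S\circ L\colon\mathbf{Matr}_\bullet\to\mathbf{Matr}_\bullet$ (the monad induced by the adjunction $L\dashv S$). Its category of Eilenberg--Moore algebras is isomorphic to $\mathbf{SMatr}_\bullet$.
   Context: All matroids are finite. A strong map from $M$ to $N$ is a function $f\colon|M|\to|N|$ between ground sets such that the inverse image of any flat of $N$ is a flat of $M$. A loop is an element contained in every flat; nonloop elements of the same rank-1 flat are parallel. A pointed matroid is a matroid with a distinguished loop $\bullet$; $\mathbf{Matr}_\bullet$ is the category of pointed matroids and strong maps preserving the distinguished loop. $\mathbf{SMatr}_\bullet$ is its full subcategory of simple pointed matroids: those having no loops other than $\bullet$ and no two distinct parallel elements. $\mathbf{GLat}$ is the category whose objects are (finite) geometric lattices and whose morphisms are functions that preserve joins (including the empty join) and that map every atom to either an atom or the least element; isomorphic lattices are identified. The functor $L\colon\mathbf{Matr}_\bullet\to\mathbf{GLat}$ sends $M$ to its lattice of flats ordered by inclusion and $f\colon M\to N$ to $X\mapsto\mathrm{cl}(f(X))$. The functor $S\colon\mathbf{GLat}\to\mathbf{Matr}_\bullet$ sends $G$ to the pointed matroid whose ground set is the set of atoms of $G$ together with a loop $\bullet$, with lattice of flats isomorphic to $G$ (the element $x\in G$ corresponding to the flat consisting of $\bullet$ and the atoms below $x$); for $f\colon G\to H$, $S(f)$ sends $\bullet$ to $\bullet$, an atom $A$ with $f(A)$ the least element to $\bullet$, and an atom $A$ with $f(A)=B$ an atom to $B$. A simplification of a matroid $M$ is a matroid obtained by deleting all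 loops and all but one (nonloop) element of each rank-1 flat; in the pointed setting the loop $\bullet$ is kept. The unit $M\to S(L(M))$ of the monad sends each element to its closure (loops being sent to $\bullet$). *)

theory Defs
  imports "HOL-Library.FSet" "HOL-Library.FuncSet" "HOL-Algebra.Lattice"
begin

section \<open>Categories, functors, adjunctions, monads\<close>

record ('o, 'm) category =
  Obj :: "'o set"
  Mor :: "'m set"
  Dom :: "'m \<Rightarrow> 'o"
  Cod :: "'m \<Rightarrow> 'o"
  Ide :: "'o \<Rightarrow> 'm"
  Cmp :: "'m \<Rightarrow> 'm \<Rightarrow> 'm"  (infixl \<open>\<odot>\<index>\<close> 70)

text \<open>Composition is written in the order of function composition: \<open>g \<odot> f\<close> is \<open>f\<close> followed by
  \<open>g\<close>. The operations are only constrained on \<^const>\<open>Obj\<close> and \<^const>\<open>Mor\<close>.\<close>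

definition hom_set :: "('o, 'm) category \<Rightarrow> 'o \<Rightarrow> 'o \<Rightarrow> 'm set" where
  "hom_set C A B = {f \<in> Mor C. Dom C f = A \<and> Cod C f = B}"

locale category =
  fixes C :: "('o, 'm) category" (structure)
  assumes dom_closed: "f \<in> Mor C \<Longrightarrow> Dom C f \<in> Obj C"
    and cod_closed: "f \<in> Mor C \<Longrightarrow> Cod C f \<in> Obj C"
    and ide_hom: "A \<in> Obj C \<Longrightarrow> Ide C A \<in> hom_set C A A"
    and cmp_hom: "\<lbrakk>f \<in> hom_set C X Y; g \<in> hom_set C Y Z\<rbrakk> \<Longrightarrow> g \<odot> f \<in> hom_set C X Z"
    and cmp_ide_right: "f \<in> hom_set C X Y \<Longrightarrow> f \<odot> Ide C X = f"
    and cmp_ide_left: "f \<in> hom_set C X Y \<Longrightarrow> Ide C Y \<odot> f = f"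
    and cmp_assoc: "\<lbrakk>f \<in> hom_set C W X; g \<in> hom_set C X Y; h \<in> hom_set C Y Z\<rbrakk>
      \<Longrightarrow> (h \<odot> g) \<odot> f = h \<odot> (g \<odot> f)"

definition isomorphic_in :: "('o, 'm) category \<Rightarrow> 'o \<Rightarrow> 'o \<Rightarrow> bool" where
  "isomorphic_in C A B \<longleftrightarrow> A \<in> Obj C \<and> B \<in> Obj C \<and>
     (\<exists>f \<in> hom_set C A B. \<exists>g \<in> hom_set C B A.
        g \<odot>\<^bsub>C\<^esub> f = Ide C A \<and> f \<odot>\<^bsub>C\<^esub> g = Ide C B)"

definition full_subcategory :: "('o, 'm) category \<Rightarrow> ('o \<Rightarrow> bool) \<Rightarrow> ('o, 'm) category" where
  "full_subcategory C P = C\<lparr>Obj := {A \<in> Obj C. P A},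
     Mor := {f \<in> Mor C. P (Dom C f) \<and> P (Cod C f)}\<rparr>"

record ('o, 'm, 'p, 'n) fctr =
  on_obj :: "'o \<Rightarrow> 'p"
  on_mor :: "'m \<Rightarrow> 'n"

locale is_functor = C: category C + D: category D
  for C :: "('o, 'm) category" and D :: "('p, 'n) category" +
  fixes F :: "('o, 'm, 'p, 'n) fctr"
  assumes on_obj_closed: "A \<in> Obj C \<Longrightarrow> on_obj F A \<in> Obj D"
    and on_mor_hom: "f \<in> hom_set C A B \<Longrightarrow> on_mor F f \<in> hom_set D (on_obj F A) (on_obj F B)"
    and on_mor_ide: "A \<in> Obj C \<Longrightarrow> on_mor F (Ide C A) = Ide D (on_obj F A)"
    and on_mor_cmp: "\<lbrakk>f \<in> hom_set C X Y; g \<in> hom_set C Y Z\<rbrakk>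
      \<Longrightarrow> on_mor F (g \<odot>\<^bsub>C\<^esub> f) = on_mor F g \<odot>\<^bsub>D\<^esub> on_mor F f"

definition id_fctr :: "('o, 'm, 'o, 'm) fctr" where
  "id_fctr = \<lparr>on_obj = (\<lambda>A. A), on_mor = (\<lambda>f. f)\<rparr>"

definition comp_fctr ::
    "('p, 'n, 'q, 'k) fctr \<Rightarrow> ('o, 'm, 'p, 'n) fctr \<Rightarrow> ('o, 'm, 'q, 'k) fctr" where
  "comp_fctr G F = \<lparr>on_obj = (\<lambda>A. on_obj G (on_obj F A)), on_mor = (\<lambda>f. on_mor G (on_mor F f))\<rparr>"

definition isomorphic_categories :: "('o, 'm) category \<Rightarrow> ('p, 'n) category \<Rightarrow> bool" where
  "isomorphic_categories C D \<longleftrightarrow>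
     (\<exists>F G. is_functor C D F \<and> is_functor D C G \<and>
        (\<forall>A \<in> Obj C. on_obj G (on_obj F A) = A) \<and> (\<forall>f \<in> Mor C. on_mor G (on_mor F f) = f) \<and>
        (\<forall>B \<in> Obj D. on_obj F (on_obj G B) = B) \<and> (\<forall>g \<in> Mor D. on_mor F (on_mor G g) = g))"

locale nat_trans = F: is_functor C D F + G: is_functor C D G
  for C :: "('o, 'm) category" and D :: "('p, 'n) category"
    and F G :: "('o, 'm, 'p, 'n) fctr" +
  fixes \<tau> :: "'o \<Rightarrow> 'n"
  assumes component_hom: "A \<in> Obj C \<Longrightarrow> \<tau> A \<in> hom_set D (on_obj F A) (on_obj G A)"
    and naturality: "f \<in> hom_set C A B \<Longrightarrow> \<tau> B \<odot>\<^bsub>D\<^esub> on_mor F f = on_mor G f \<odot>\<^bsub>D\<^esub> \<tau> A"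

text \<open>\<open>L\<close> is left adjoint to \<open>R\<close>, with unit \<open>\<eta>\<close> and counit \<open>\<epsilon>\<close>.\<close>

locale adjunction =
  L: is_functor C D L + R: is_functor D C R +
  unit: nat_trans C C id_fctr "comp_fctr R L" \<eta> +
  counit: nat_trans D D "comp_fctr L R" id_fctr \<epsilon>
  for C :: "('o, 'm) category" and D :: "('p, 'n) category"
    and L :: "('o, 'm, 'p, 'n) fctr" and R :: "('p, 'n, 'o, 'm) fctr"
    and \<eta> :: "'o \<Rightarrow> 'm" and \<epsilon> :: "'p \<Rightarrow> 'n" +
  assumes triangle_left: "A \<in> Obj C \<Longrightarrow> \<epsilon> (on_obj L A) \<odot>\<^bsub>D\<^esub> on_mor L (\<eta> A) = Ide D (on_obj L A)"
    and triangle_right: "B \<in> Obj D \<Longrightarrow> on_mor R (\<epsilon> B) \<odot>\<^bsub>C\<^esub> \<eta> (on_obj R B) = Ide C (on_obj R B)"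

locale monad =
  T: is_functor C C T +
  unit: nat_trans C C id_fctr T \<eta> +
  mult: nat_trans C C "comp_fctr T T" T \<mu>
  for C :: "('o, 'm) category" and T :: "('o, 'm, 'o, 'm) fctr"
    and \<eta> :: "'o \<Rightarrow> 'm" and \<mu> :: "'o \<Rightarrow> 'm" +
  assumes mult_assoc: "A \<in> Obj C \<Longrightarrow> \<mu> A \<odot>\<^bsub>C\<^esub> on_mor T (\<mu> A) = \<mu> A \<odot>\<^bsub>C\<^esub> \<mu> (on_obj T A)"
    and mult_unit_left: "A \<in> Obj C \<Longrightarrow> \<mu> A \<odot>\<^bsub>C\<^esub> \<eta> (on_obj T A) = Ide C (on_obj T A)"
    and mult_unit_right: "A \<in> Obj C \<Longrightarrow> \<mu> A \<odot>\<^bsub>C\<^esub> on_mor T (\<eta> A) = Ide C (on_obj T A)"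

text \<open>The multiplication \<open>R \<epsilon> L\<close> of the monad \<open>(R L, \<eta>, R \<epsilon> L)\<close> induced by an adjunction.\<close>

definition induced_mult ::
    "('o, 'm, 'p, 'n) fctr \<Rightarrow> ('p, 'n, 'o, 'm) fctr \<Rightarrow> ('p \<Rightarrow> 'n) \<Rightarrow> 'o \<Rightarrow> 'm" where
  "induced_mult L R \<epsilon> A = on_mor R (\<epsilon> (on_obj L A))"

definition EM_algebra ::
    "('o, 'm) category \<Rightarrow> ('o, 'm, 'o, 'm) fctr \<Rightarrow> ('o \<Rightarrow> 'm) \<Rightarrow> ('o \<Rightarrow> 'm) \<Rightarrow> 'o \<times> 'm \<Rightarrow> bool" where
  "EM_algebra C T \<eta> \<mu> = (\<lambda>(A, h). A \<in> Obj C \<and> h \<in> hom_set C (on_obj T A) A \<and>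
     h \<odot>\<^bsub>C\<^esub> \<eta> A = Ide C A \<and> h \<odot>\<^bsub>C\<^esub> on_mor T h = h \<odot>\<^bsub>C\<^esub> \<mu> A)"

definition EM_morphism ::
    "('o, 'm) category \<Rightarrow> ('o, 'm, 'o, 'm) fctr \<Rightarrow> 'o \<times> 'm \<Rightarrow> 'o \<times> 'm \<Rightarrow> 'm \<Rightarrow> bool" where
  "EM_morphism C T = (\<lambda>(A, h) (B, k) f.
     f \<in> hom_set C A B \<and> f \<odot>\<^bsub>C\<^esub> h = k \<odot>\<^bsub>C\<^esub> on_mor T f)"

text \<open>A morphism of algebras is a triple (source algebra, underlying morphism, target algebra),
  since the underlying morphism does not determine the algebra structures.\<close>

definition EM_category ::
    "('o, 'm) category \<Rightarrow> ('o, 'm, 'o, 'm) fctr \<Rightarrow> ('o \<Rightarrow> 'm) \<Rightarrow> ('o \<Rightarrow> 'm) \<Rightarrow>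
     ('o \<times> 'm, ('o \<times> 'm) \<times> 'm \<times> ('o \<times> 'm)) category" where
  "EM_category C T \<eta> \<mu> =
     \<lparr>Obj = {a. EM_algebra C T \<eta> \<mu> a},
      Mor = {(a, f, b). EM_algebra C T \<eta> \<mu> a \<and> EM_algebra C T \<eta> \<mu> b \<and> EM_morphism C T a b f},
      Dom = (\<lambda>(a, f, b). a),
      Cod = (\<lambda>(a, f, b). b),
      Ide = (\<lambda>a. (a, Ide C (fst a), a)),
      Cmp = (\<lambda>(b', g, c) (a, f, b). (a, g \<odot>\<^bsub>C\<^esub> f, c))\<rparr>"

text \<open>Categories of structured sets. A morphism records its source and target; the underlying
  function is \<^const>\<open>undefined\<close> outside the carrier of its source, so that equality of morphisms is
  equality of functions on that carrier.\<close>

datatype ('o, 'e) arrow = Arrow (source: 'o) (fn: "'e \<Rightarrow> 'e") (target: 'o)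

definition concrete_category ::
    "'o set \<Rightarrow> ('o \<Rightarrow> 'e set) \<Rightarrow> ('o \<Rightarrow> 'o \<Rightarrow> ('e \<Rightarrow> 'e) \<Rightarrow> bool) \<Rightarrow> ('o, ('o, 'e) arrow) category" where
  "concrete_category Ob car P =
     \<lparr>Obj = Ob,
      Mor = {Arrow A f B | A f B. A \<in> Ob \<and> B \<in> Ob \<and> f \<in> car A \<rightarrow>\<^sub>E car B \<and> P A B f},
      Dom = source,
      Cod = target,
      Ide = (\<lambda>A. Arrow A (\<lambda>x\<in>car A. x) A),
      Cmp = (\<lambda>g f. Arrow (source f) (compose (car (source f)) (fn g) (fn f)) (target g))\<rparr>"


section \<open>Pointed matroids and strong maps\<close>

text \<open>Finite matroids, given by the standard axioms for the family of flats: the ground set is a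
  flat, flats are closed under intersection, and the flats covering a flat \<open>F\<close> partition the
  elements outside \<open>F\<close>.\<close>

record 'e pmatroid =
  ground :: "'e set"
  flats :: "'e set set"
  point :: 'e

definition covers_flat :: "'e pmatroid \<Rightarrow> 'e set \<Rightarrow> 'e set \<Rightarrow> bool" where
  "covers_flat M F F' \<longleftrightarrow> F \<in> flats M \<and> F' \<in> flats M \<and> F \<subset> F' \<and> (\<forall>K \<in> flats M. \<not> (F \<subset> K \<and> K \<subset> F'))"

definition is_matroid :: "'e pmatroid \<Rightarrow> bool" where
  "is_matroid M \<longleftrightarrow> finite (ground M) \<and> flats M \<subseteq> Pow (ground M) \<and> ground M \<in> flats M \<and>
     (\<forall>F \<in> flats M. \<forall>K \<in> flats M. F \<inter> K \<in> flats M) \<and>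
     (\<forall>F \<in> flats M. \<forall>x \<in> ground M - F. \<exists>!F'. covers_flat M F F' \<and> x \<in> F')"

definition cl :: "'e pmatroid \<Rightarrow> 'e set \<Rightarrow> 'e set" where
  "cl M X = \<Inter>{F \<in> flats M. X \<subseteq> F}"

definition loop :: "'e pmatroid \<Rightarrow> 'e \<Rightarrow> bool" where
  "loop M x \<longleftrightarrow> x \<in> ground M \<and> (\<forall>F \<in> flats M. x \<in> F)"

definition nonloop :: "'e pmatroid \<Rightarrow> 'e \<Rightarrow> bool" where
  "nonloop M x \<longleftrightarrow> x \<in> ground M \<and> \<not> loop M x"

definition indep :: "'e pmatroid \<Rightarrow> 'e set \<Rightarrow> bool" where
  "indep M I \<longleftrightarrow> I \<subseteq> ground M \<and> (\<forall>x \<in> I. x \<notin> cl M (I - {x}))"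

definition rank :: "'e pmatroid \<Rightarrow> 'e set \<Rightarrow> nat" where
  "rank M X = Max (card ` {I. indep M I \<and> I \<subseteq> X})"

definition rank1_flat :: "'e pmatroid \<Rightarrow> 'e set \<Rightarrow> bool" where
  "rank1_flat M F \<longleftrightarrow> F \<in> flats M \<and> rank M F = 1"

definition parallel :: "'e pmatroid \<Rightarrow> 'e \<Rightarrow> 'e \<Rightarrow> bool" where
  "parallel M x y \<longleftrightarrow> nonloop M x \<and> nonloop M y \<and> (\<exists>F. rank1_flat M F \<and> x \<in> F \<and> y \<in> F)"

definition is_pointed_matroid :: "'e pmatroid \<Rightarrow> bool" where
  "is_pointed_matroid M \<longleftrightarrow> is_matroid M \<and> loop M (point M)"

definition simple_pointed :: "'e pmatroid \<Rightarrow> bool" where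
  "simple_pointed M \<longleftrightarrow> (\<forall>x. loop M x \<longrightarrow> x = point M) \<and> (\<forall>x y. parallel M x y \<longrightarrow> x = y)"

definition strong_map :: "'e pmatroid \<Rightarrow> 'e pmatroid \<Rightarrow> ('e \<Rightarrow> 'e) \<Rightarrow> bool" where
  "strong_map M N f \<longleftrightarrow> f ` ground M \<subseteq> ground N \<and> (\<forall>F \<in> flats N. {x \<in> ground M. f x \<in> F} \<in> flats M)"

definition delete :: "'e pmatroid \<Rightarrow> 'e set \<Rightarrow> 'e pmatroid" where
  "delete M D = \<lparr>ground = ground M - D, flats = {F - D | F. F \<in> flats M}, point = point M\<rparr>"

text \<open>\<open>N\<close> is a pointed simplification of \<open>M\<close>: the loops other than the point are deleted, and all
  but one nonloop of each rank-1 flat.\<close>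

definition simplification_of :: "'e pmatroid \<Rightarrow> 'e pmatroid \<Rightarrow> bool" where
  "simplification_of N M \<longleftrightarrow> (\<exists>D \<subseteq> ground M - {point M}. N = delete M D \<and>
     (\<forall>x. loop M x \<and> x \<noteq> point M \<longrightarrow> x \<in> D) \<and>
     (\<forall>F. rank1_flat M F \<longrightarrow> (\<exists>!x. x \<in> F \<and> nonloop M x \<and> x \<notin> D)))"


section \<open>Geometric lattices\<close>

definition lcovers :: "'l gorder \<Rightarrow> 'l \<Rightarrow> 'l \<Rightarrow> bool" where
  "lcovers G x y \<longleftrightarrow> x \<in> carrier G \<and> y \<in> carrier G \<and> x \<sqsubset>\<^bsub>G\<^esub> y \<and>
     (\<forall>z \<in> carrier G. \<not> (x \<sqsubset>\<^bsub>G\<^esub> z \<and> z \<sqsubset>\<^bsub>G\<^esub> y))"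

definition atoms :: "'l gorder \<Rightarrow> 'l set" where
  "atoms G = {a. lcovers G \<bottom>\<^bsub>G\<^esub> a}"

text \<open>Finite, atomistic and upper semimodular.\<close>

definition geometric_lattice :: "'l gorder \<Rightarrow> bool" where
  "geometric_lattice G \<longleftrightarrow> bounded_lattice G \<and> finite (carrier G) \<and>
     (\<forall>x \<in> carrier G. \<exists>A \<subseteq> atoms G. x = \<Squnion>\<^bsub>G\<^esub> A) \<and>
     (\<forall>x \<in> carrier G. \<forall>y \<in> carrier G.
        lcovers G (x \<sqinter>\<^bsub>G\<^esub> y) x \<longrightarrow> lcovers G y (x \<squnion>\<^bsub>G\<^esub> y))"

definition glat_morphism :: "'l gorder \<Rightarrow> 'l gorder \<Rightarrow> ('l \<Rightarrow> 'l) \<Rightarrow> bool" where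
  "glat_morphism G H f \<longleftrightarrow> f ` carrier G \<subseteq> carrier H \<and>
     (\<forall>A \<subseteq> carrier G. f (\<Squnion>\<^bsub>G\<^esub> A) = \<Squnion>\<^bsub>H\<^esub> (f ` A)) \<and>
     (\<forall>a \<in> atoms G. f a \<in> atoms H \<or> f a = \<bottom>\<^bsub>H\<^esub>)"


section \<open>The categories\<close>

text \<open>The categories need a type of elements that is closed under the functors below, which turn a
  flat of one matroid into an element of another one. The type \<open>'a elt\<close> is the universe of
  hereditarily finite sets built from the urelements \<open>Base a\<close> and a special element \<open>Bullet\<close>.
  Matroids have ground sets in \<open>'a elt\<close>, lattices have carriers in \<open>'a elt fset\<close>. Both types are
  infinite, so every finite pointed matroid and every finite lattice has an isomorphic copy
  there.\<close>

datatype 'a elt = Base 'a | Bullet | Elem "'a elt fset"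

type_synonym 'a matr = "'a elt pmatroid"
type_synonym 'a glat = "'a elt fset gorder"
type_synonym 'a matr_arrow = "('a matr, 'a elt) arrow"
type_synonym 'a glat_arrow = "('a glat, 'a elt fset) arrow"

definition Matr :: "('a matr, 'a matr_arrow) category" where
  "Matr = concrete_category {M. is_pointed_matroid M} ground
     (\<lambda>M N f. strong_map M N f \<and> f (point M) = point N)"

definition SMatr :: "('a matr, 'a matr_arrow) category" where
  "SMatr = full_subcategory Matr simple_pointed"

definition GLat :: "('a glat, 'a glat_arrow) category" where
  "GLat = concrete_category {G. geometric_lattice G} carrier glat_morphism"


section \<open>The functors, the unit and the counit\<close>

definition L_obj :: "'a matr \<Rightarrow> 'a glat" where
  "L_obj M = \<lparr>carrier = {F. fset F \<in> flats M}, eq = (=), le = (|\<subseteq>|)\<rparr>"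

definition L_mor :: "'a matr_arrow \<Rightarrow> 'a glat_arrow" where
  "L_mor f = Arrow (L_obj (source f))
     (\<lambda>F\<in>carrier (L_obj (source f)). Abs_fset (cl (target f) (fn f ` fset F)))
     (L_obj (target f))"

definition L_functor :: "('a matr, 'a matr_arrow, 'a glat, 'a glat_arrow) fctr" where
  "L_functor = \<lparr>on_obj = L_obj, on_mor = L_mor\<rparr>"

definition S_obj :: "'a glat \<Rightarrow> 'a matr" where
  "S_obj G = \<lparr>ground = insert Bullet (Elem ` atoms G),
     flats = {insert Bullet (Elem ` {a \<in> atoms G. a \<sqsubseteq>\<^bsub>G\<^esub> x}) | x. x \<in> carrier G},
     point = Bullet\<rparr>"

definition S_mor :: "'a glat_arrow \<Rightarrow> 'a matr_arrow" where
  "S_mor f = Arrow (S_obj (source f))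
     (\<lambda>e\<in>ground (S_obj (source f)).
        case e of
          Elem a \<Rightarrow> if fn f a = \<bottom>\<^bsub>target f\<^esub> then Bullet else Elem (fn f a)
        | _ \<Rightarrow> Bullet)
     (S_obj (target f))"

definition S_functor :: "('a glat, 'a glat_arrow, 'a matr, 'a matr_arrow) fctr" where
  "S_functor = \<lparr>on_obj = S_obj, on_mor = S_mor\<rparr>"

definition si :: "('a matr, 'a matr_arrow, 'a matr, 'a matr_arrow) fctr" where
  "si = comp_fctr S_functor L_functor"

definition si_unit :: "'a matr \<Rightarrow> 'a matr_arrow" where
  "si_unit M = Arrow M
     (\<lambda>x\<in>ground M. if loop M x then Bullet else Elem (Abs_fset (cl M {x})))
     (S_obj (L_obj M))"

text \<open>The canonical isomorphism \<open>L (S G) \<rightarrow> G\<close>, sending the flat of atoms below \<open>x\<close> to \<open>x\<close>.\<close>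

definition counit :: "'a glat \<Rightarrow> 'a glat_arrow" where
  "counit G = Arrow (L_obj (S_obj G))
     (\<lambda>F\<in>carrier (L_obj (S_obj G)). \<Squnion>\<^bsub>G\<^esub> {a \<in> atoms G. Elem a |\<in>| F})
     G"

definition si_mult :: "'a matr \<Rightarrow> 'a matr_arrow" where
  "si_mult = induced_mult L_functor S_functor counit"

end

theory Submission
  imports Defs
begin

text \<open>
  A strong map satisfies \<open>f (cl X) \<subseteq> cl (f X)\<close>, so \<open>X \<mapsto> cl (f X)\<close> preserves joins of flats and
  sends the closure of one element to the closure of one element; this makes \<open>L\<close> a functor
  (\<open>L_mor_morphism\<close>). In the other direction, a join-preserving map between finite lattices has an upper adjoint, which computes
  the preimages of flats and makes \<open>S g\<close> strong (\<open>S_mor_strong\<close>). That flats form a geometric lattice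
  (\<open>L_geometric\<close>) and that atoms form a matroid (\<open>S_is_matroid\<close>) are two readings of one fact: in both
  settings the elements covering \<open>F\<close> are the joins of \<open>F\<close> with an atom that is not below \<open>F\<close>.

  The flats of \<open>S G\<close> are the sets \<open>atom_flat G x\<close> of the atoms below an element \<open>x\<close>, together with the
  point. Two facts about them carry the adjunction. The unit pulls \<open>atom_flat (L M) F\<close> back to \<open>F\<close>
  (\<open>si_unit_mem_atom_flat\<close>), and the counit sends \<open>atom_flat G x\<close> to \<open>x\<close> because \<open>G\<close> is atomistic
  (\<open>counit_apply\<close>). All naturality squares and triangle identities are reduced to these two. The monad
  laws then follow formally (\<open>adjunction.induced_monad\<close>).

  The unit of \<open>M\<close> identifies exactly the loops with each other and parallel elements with each other.
  Hence it becomes bijective when it is restricted to a simplification of \<open>M\<close>, and since flats still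
  correspond to flats, the restriction is an isomorphism (\<open>restricted_unit_invertible\<close>). A simple
  pointed matroid is its own simplification, so its unit is invertible. Conversely, an algebra
  structure is a left inverse of the unit, so it forces the unit to be injective and the matroid to be
  simple (\<open>simple_of_unit_retraction\<close>).

  These two statements determine the algebras of any monad: where the unit is invertible its inverse
  is the only algebra structure, and every morphism between such objects is a morphism of algebras
  (\<open>monad.EM_isomorphic_full_subcategory\<close>). So the algebras of simplification form a category
  isomorphic to the full subcategory of simple pointed matroids.
\<close>

section \<open>The monad of an adjunction and its algebras\<close>

lemma is_functor_id: "category C \<Longrightarrow> is_functor C C id_fctr"
  by (simp add: is_functor_def is_functor_axioms_def id_fctr_def)

lemma is_functor_comp:
  assumes "is_functor C D F" "is_functor D E G"
  shows "is_functor C E (comp_fctr G F)"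
proof -
  interpret F: is_functor C D F by fact
  interpret G: is_functor D E G by fact
  show ?thesis
    by unfold_locales
      (auto simp: comp_fctr_def F.on_obj_closed G.on_obj_closed F.on_mor_hom G.on_mor_hom
        F.on_mor_ide G.on_mor_ide F.on_mor_cmp intro: G.on_mor_cmp F.on_mor_hom)
qed

context adjunction
begin

lemma unit_hom: "A \<in> Obj C \<Longrightarrow> \<eta> A \<in> hom_set C A (on_obj R (on_obj L A))"
  using unit.component_hom by (simp add: id_fctr_def comp_fctr_def)

lemma counit_hom: "B \<in> Obj D \<Longrightarrow> \<epsilon> B \<in> hom_set D (on_obj L (on_obj R B)) B"
  using counit.component_hom by (simp add: id_fctr_def comp_fctr_def)

lemma counit_natural:
  "g \<in> hom_set D X Y \<Longrightarrow> \<epsilon> Y \<odot>\<^bsub>D\<^esub> on_mor L (on_mor R g) = g \<odot>\<^bsub>D\<^esub> \<epsilon> X"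
  using counit.naturality by (simp add: id_fctr_def comp_fctr_def)

text \<open>All laws are images under \<open>R\<close> of laws of the adjunction: naturality and associativity of the
  multiplication are naturality of the counit (for associativity at the morphism \<open>\<epsilon> (L A)\<close>), and the
  two unit laws are the two triangle identities.\<close>

theorem induced_monad: "monad C (comp_fctr R L) \<eta> (induced_mult L R \<epsilon>)"
proof -
  let ?T = "comp_fctr R L" and ?\<mu> = "induced_mult L R \<epsilon>"
  note LO = L.on_obj_closed
  have T: "is_functor C C ?T"
    by (rule is_functor_comp[OF L.is_functor_axioms R.is_functor_axioms])
  have TT: "is_functor C C (comp_fctr ?T ?T)"
    by (rule is_functor_comp[OF T T])
  have mult_nat: "nat_trans C C (comp_fctr ?T ?T) ?T ?\<mu>"
  proof (intro nat_trans.intro nat_trans_axioms.intro T TT)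
    fix A assume "A \<in> Obj C"
    then show "?\<mu> A \<in> hom_set C (on_obj (comp_fctr ?T ?T) A) (on_obj ?T A)"
      by (simp add: comp_fctr_def induced_mult_def R.on_mor_hom counit_hom LO)
  next
    fix f A B assume f: "f \<in> hom_set C A B"
    then have A: "A \<in> Obj C" and B: "B \<in> Obj C"
      using L.C.dom_closed L.C.cod_closed by (auto simp: hom_set_def)
    have Lf: "on_mor L f \<in> hom_set D (on_obj L A) (on_obj L B)"
      by (rule L.on_mor_hom[OF f])
    have "on_mor R (\<epsilon> (on_obj L B)) \<odot>\<^bsub>C\<^esub> on_mor R (on_mor L (on_mor R (on_mor L f)))
        = on_mor R (\<epsilon> (on_obj L B) \<odot>\<^bsub>D\<^esub> on_mor L (on_mor R (on_mor L f)))"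
      by (rule R.on_mor_cmp[symmetric])
        (auto intro: L.on_mor_hom R.on_mor_hom Lf counit_hom LO B)
    also have "\<dots> = on_mor R (on_mor L f \<odot>\<^bsub>D\<^esub> \<epsilon> (on_obj L A))"
      by (simp add: counit_natural[OF Lf])
    also have "\<dots> = on_mor R (on_mor L f) \<odot>\<^bsub>C\<^esub> on_mor R (\<epsilon> (on_obj L A))"
      by (rule R.on_mor_cmp) (auto intro: Lf counit_hom LO A)
    finally show "?\<mu> B \<odot>\<^bsub>C\<^esub> on_mor (comp_fctr ?T ?T) f = on_mor ?T f \<odot>\<^bsub>C\<^esub> ?\<mu> A"
      by (simp add: comp_fctr_def induced_mult_def)
  qed
  show ?thesis
  proof (intro monad.intro monad_axioms.intro T mult_nat unit.nat_trans_axioms)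
    fix A assume A: "A \<in> Obj C"
    have e: "\<epsilon> (on_obj L A) \<in> hom_set D (on_obj L (on_obj R (on_obj L A))) (on_obj L A)"
      by (rule counit_hom[OF LO[OF A]])
    have RLA: "on_obj L (on_obj R (on_obj L A)) \<in> Obj D"
      by (intro LO R.on_obj_closed A)
    have "on_mor R (\<epsilon> (on_obj L A)) \<odot>\<^bsub>C\<^esub> on_mor R (on_mor L (on_mor R (\<epsilon> (on_obj L A))))
        = on_mor R (\<epsilon> (on_obj L A) \<odot>\<^bsub>D\<^esub> on_mor L (on_mor R (\<epsilon> (on_obj L A))))"
      by (rule R.on_mor_cmp[symmetric]) (auto intro: L.on_mor_hom R.on_mor_hom e)
    also have "\<dots> = on_mor R (\<epsilon> (on_obj L A) \<odot>\<^bsub>D\<^esub> \<epsilon> (on_obj L (on_obj R (on_obj L A))))"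
      by (simp add: counit_natural[OF e])
    also have "\<dots> = on_mor R (\<epsilon> (on_obj L A)) \<odot>\<^bsub>C\<^esub> on_mor R (\<epsilon> (on_obj L (on_obj R (on_obj L A))))"
      by (rule R.on_mor_cmp) (auto intro: e counit_hom RLA)
    finally show "?\<mu> A \<odot>\<^bsub>C\<^esub> on_mor ?T (?\<mu> A) = ?\<mu> A \<odot>\<^bsub>C\<^esub> ?\<mu> (on_obj ?T A)"
      by (simp add: comp_fctr_def induced_mult_def)
    show "?\<mu> A \<odot>\<^bsub>C\<^esub> \<eta> (on_obj ?T A) = Ide C (on_obj ?T A)"
      using triangle_right[OF LO[OF A]] by (simp add: comp_fctr_def induced_mult_def)
    have "on_mor R (\<epsilon> (on_obj L A)) \<odot>\<^bsub>C\<^esub> on_mor R (on_mor L (\<eta> A))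
        = on_mor R (\<epsilon> (on_obj L A) \<odot>\<^bsub>D\<^esub> on_mor L (\<eta> A))"
      by (rule R.on_mor_cmp[symmetric]) (auto intro: L.on_mor_hom e unit_hom A)
    also have "\<dots> = Ide C (on_obj R (on_obj L A))"
      by (simp add: triangle_left[OF A] R.on_mor_ide LO[OF A])
    finally show "?\<mu> A \<odot>\<^bsub>C\<^esub> on_mor ?T (\<eta> A) = Ide C (on_obj ?T A)"
      by (simp add: comp_fctr_def induced_mult_def)
  qed
qed

end

lemma category_full_subcategory:
  assumes "category C" shows "category (full_subcategory C P)"
proof -
  interpret category C by fact
  show ?thesis
    using dom_closed cod_closed ide_hom cmp_hom cmp_ide_left cmp_ide_right cmp_assoc
    by unfold_locales (auto simp: full_subcategory_def hom_set_def)
qed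

context monad
begin

lemma unit_hom: "A \<in> Obj C \<Longrightarrow> \<eta> A \<in> hom_set C A (on_obj T A)"
  using unit.component_hom by (simp add: id_fctr_def)

lemma unit_natural: "f \<in> hom_set C A B \<Longrightarrow> \<eta> B \<odot>\<^bsub>C\<^esub> f = on_mor T f \<odot>\<^bsub>C\<^esub> \<eta> A"
  using unit.naturality by (simp add: id_fctr_def)

lemma mult_hom: "A \<in> Obj C \<Longrightarrow> \<mu> A \<in> hom_set C (on_obj T (on_obj T A)) (on_obj T A)"
  using mult.component_hom by (simp add: comp_fctr_def)

lemma hom_objD: "f \<in> hom_set C A B \<Longrightarrow> A \<in> Obj C" "f \<in> hom_set C A B \<Longrightarrow> B \<in> Obj C"
  using T.C.dom_closed T.C.cod_closed by (auto simp: hom_set_def)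

lemma category_EM: "category (EM_category C T \<eta> \<mu>)"
proof
  let ?E = "EM_category C T \<eta> \<mu>"
  {
    fix A assume "A \<in> Obj ?E"
    then obtain M h where A: "A = (M, h)" "EM_algebra C T \<eta> \<mu> (M, h)" 
      by (cases A) (auto simp: EM_category_def)
    then have "M \<in> Obj C" and h: "h \<in> hom_set C (on_obj T M) M" by (auto simp: EM_algebra_def)
    then have "EM_morphism C T (M, h) (M, h) (Ide C M)"
      by (simp add: EM_morphism_def T.C.ide_hom T.on_mor_ide T.C.cmp_ide_left T.C.cmp_ide_right)
    with A show "Ide ?E A \<in> hom_set ?E A A"
      by (simp add: EM_category_def hom_set_def)
  next
    fix f g X Y Z assume f: "f \<in> hom_set ?E X Y" and g: "g \<in> hom_set ?E Y Z"
    obtain A h where X: "X = (A, h)" by force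
    obtain B k where Y: "Y = (B, k)" by force
    obtain D l where Z: "Z = (D, l)" by force
    obtain \<phi> where f': "f = (X, \<phi>, Y)" using f by (auto simp: hom_set_def EM_category_def)
    obtain \<psi> where g': "g = (Y, \<psi>, Z)" using g by (auto simp: hom_set_def EM_category_def)
    have al: "h \<in> hom_set C (on_obj T A) A" "k \<in> hom_set C (on_obj T B) B"
      "l \<in> hom_set C (on_obj T D) D"
      using f g unfolding f' g' X Y Z by (auto simp: hom_set_def EM_category_def EM_algebra_def)
    have \<phi>: "\<phi> \<in> hom_set C A B" "\<phi> \<odot>\<^bsub>C\<^esub> h = k \<odot>\<^bsub>C\<^esub> on_mor T \<phi>"
      using f unfolding f' X Y by (auto simp: hom_set_def EM_category_def EM_morphism_def)
    have \<psi>: "\<psi> \<in> hom_set C B D" "\<psi> \<odot>\<^bsub>C\<^esub> k = l \<odot>\<^bsub>C\<^esub> on_mor T \<psi>"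
      using g unfolding g' Y Z by (auto simp: hom_set_def EM_category_def EM_morphism_def)
    have "(\<psi> \<odot>\<^bsub>C\<^esub> \<phi>) \<odot>\<^bsub>C\<^esub> h = \<psi> \<odot>\<^bsub>C\<^esub> (k \<odot>\<^bsub>C\<^esub> on_mor T \<phi>)"
      using T.C.cmp_assoc[OF al(1) \<phi>(1) \<psi>(1)] \<phi>(2) by simp
    also have "\<dots> = (\<psi> \<odot>\<^bsub>C\<^esub> k) \<odot>\<^bsub>C\<^esub> on_mor T \<phi>"
      using T.C.cmp_assoc[OF T.on_mor_hom[OF \<phi>(1)] al(2) \<psi>(1)] by simp
    also have "\<dots> = l \<odot>\<^bsub>C\<^esub> (on_mor T \<psi> \<odot>\<^bsub>C\<^esub> on_mor T \<phi>)"
      using T.C.cmp_assoc[OF T.on_mor_hom[OF \<phi>(1)] T.on_mor_hom[OF \<psi>(1)] al(3)] \<psi>(2) by simp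
    also have "on_mor T \<psi> \<odot>\<^bsub>C\<^esub> on_mor T \<phi> = on_mor T (\<psi> \<odot>\<^bsub>C\<^esub> \<phi>)"
      using T.on_mor_cmp[OF \<phi>(1) \<psi>(1)] by simp
    finally have "EM_morphism C T X Z (\<psi> \<odot>\<^bsub>C\<^esub> \<phi>)"
      using T.C.cmp_hom[OF \<phi>(1) \<psi>(1)] by (simp add: EM_morphism_def X Z)
    then show "Cmp ?E g f \<in> hom_set ?E X Z"
      using f g by (auto simp: hom_set_def EM_category_def f' g')
  }
qed (auto simp: EM_category_def hom_set_def EM_morphism_def intro: T.C.cmp_ide_left
      T.C.cmp_ide_right T.C.cmp_assoc)

text \<open>By \<open>\<mu> \<circ> T \<eta> = id\<close> the multiplication is the inverse of \<open>T \<eta>\<close> as soon as \<open>T \<eta>\<close> is invertible.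
  If \<open>h\<close> inverts \<open>\<eta>\<close>, then \<open>T h\<close> inverts \<open>T \<eta>\<close>, so \<open>\<mu> = T h\<close> and the associativity law
  \<open>h \<circ> T h = h \<circ> \<mu>\<close> is trivial.\<close>

lemma EM_algebra_inverse_unit:
  assumes A: "A \<in> Obj C" and h: "h \<in> hom_set C (on_obj T A) A"
    and left: "h \<odot>\<^bsub>C\<^esub> \<eta> A = Ide C A" and right: "\<eta> A \<odot>\<^bsub>C\<^esub> h = Ide C (on_obj T A)"
  shows "EM_algebra C T \<eta> \<mu> (A, h)"
proof -
  have TA: "on_obj T A \<in> Obj C" by (rule T.on_obj_closed[OF A])
  note homs = h mult_hom[OF A] T.on_mor_hom[OF h] T.on_mor_hom[OF unit_hom[OF A]]
  have "\<mu> A = \<mu> A \<odot>\<^bsub>C\<^esub> on_mor T (\<eta> A \<odot>\<^bsub>C\<^esub> h)"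
    using mult_hom[OF A] by (simp add: right T.on_mor_ide TA T.C.cmp_ide_right)
  also have "\<dots> = (\<mu> A \<odot>\<^bsub>C\<^esub> on_mor T (\<eta> A)) \<odot>\<^bsub>C\<^esub> on_mor T h"
    using T.C.cmp_assoc[OF homs(3,4,2)] T.on_mor_cmp[OF h unit_hom[OF A]] by simp
  also have "\<dots> = on_mor T h"
    by (simp add: mult_unit_right A T.C.cmp_ide_left[OF homs(3)])
  finally show ?thesis
    using A h left by (simp add: EM_algebra_def)
qed

lemma EM_algebra_unique:
  assumes "EM_algebra C T \<eta> \<mu> (A, h)" and g: "g \<in> hom_set C (on_obj T A) A"
    and right: "\<eta> A \<odot>\<^bsub>C\<^esub> g = Ide C (on_obj T A)"
  shows "h = g"
proof -
  have A: "A \<in> Obj C" and h: "h \<in> hom_set C (on_obj T A) A" and left: "h \<odot>\<^bsub>C\<^esub> \<eta> A = Ide C A"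
    using assms(1) by (auto simp: EM_algebra_def)
  have "h = h \<odot>\<^bsub>C\<^esub> (\<eta> A \<odot>\<^bsub>C\<^esub> g)" by (simp add: right T.C.cmp_ide_right[OF h])
  also have "\<dots> = g"
    using T.C.cmp_assoc[OF g unit_hom[OF A] h] by (simp add: left T.C.cmp_ide_left[OF g])
  finally show ?thesis .
qed

text \<open>The algebra morphism equation \<open>f \<circ> h = k \<circ> T f\<close> is the naturality square
  \<open>\<eta> \<circ> f = T f \<circ> \<eta>\<close> with the two units moved to the other side, where they become \<open>k\<close> and \<open>h\<close>.\<close>

lemma EM_morphism_inverse_unit:
  assumes f: "f \<in> hom_set C A B"
    and h: "h \<in> hom_set C (on_obj T A) A" and right: "\<eta> A \<odot>\<^bsub>C\<^esub> h = Ide C (on_obj T A)"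
    and k: "k \<in> hom_set C (on_obj T B) B" and left: "k \<odot>\<^bsub>C\<^esub> \<eta> B = Ide C B"
  shows "EM_morphism C T (A, h) (B, k) f"
proof -
  note A = hom_objD(1)[OF f] and B = hom_objD(2)[OF f] and Tf = T.on_mor_hom[OF f]
  note fh = T.C.cmp_hom[OF h f]
  have "f \<odot>\<^bsub>C\<^esub> h = (k \<odot>\<^bsub>C\<^esub> \<eta> B) \<odot>\<^bsub>C\<^esub> (f \<odot>\<^bsub>C\<^esub> h)"
    by (simp add: left T.C.cmp_ide_left[OF fh])
  also have "\<dots> = k \<odot>\<^bsub>C\<^esub> ((\<eta> B \<odot>\<^bsub>C\<^esub> f) \<odot>\<^bsub>C\<^esub> h)"
    using T.C.cmp_assoc[OF fh unit_hom[OF B] k] T.C.cmp_assoc[OF h f unit_hom[OF B]] by simp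
  also have "(\<eta> B \<odot>\<^bsub>C\<^esub> f) \<odot>\<^bsub>C\<^esub> h = on_mor T f"
    using T.C.cmp_assoc[OF h unit_hom[OF A] Tf]
    by (simp add: unit_natural[OF f] right T.C.cmp_ide_right[OF Tf])
  finally show ?thesis
    using f by (simp add: EM_morphism_def)
qed

text \<open>By the lemmas above, the objects satisfying \<open>P\<close> carry exactly one algebra structure, the other
  objects carry none, and all morphisms between the former respect these structures. So forgetting
  the structure is bijective on objects and on morphisms, and choosing the inverse of the unit is the
  functor in the other direction.\<close>

theorem EM_isomorphic_full_subcategory:
  assumes alg: "\<And>A h. EM_algebra C T \<eta> \<mu> (A, h) \<Longrightarrow> P A"
    and inv: "\<And>A. A \<in> Obj C \<Longrightarrow> P A \<Longrightarrow> \<exists>h \<in> hom_set C (on_obj T A) A.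
      h \<odot>\<^bsub>C\<^esub> \<eta> A = Ide C A \<and> \<eta> A \<odot>\<^bsub>C\<^esub> h = Ide C (on_obj T A)"
  shows "isomorphic_categories (EM_category C T \<eta> \<mu>) (full_subcategory C P)"
proof -
  let ?E = "EM_category C T \<eta> \<mu>" and ?S = "full_subcategory C P"
  obtain s where s: "\<And>A. A \<in> Obj C \<Longrightarrow> P A \<Longrightarrow> s A \<in> hom_set C (on_obj T A) A"
    "\<And>A. A \<in> Obj C \<Longrightarrow> P A \<Longrightarrow> s A \<odot>\<^bsub>C\<^esub> \<eta> A = Ide C A"
    "\<And>A. A \<in> Obj C \<Longrightarrow> P A \<Longrightarrow> \<eta> A \<odot>\<^bsub>C\<^esub> s A = Ide C (on_obj T A)"
    using inv by metis
  have sA: "EM_algebra C T \<eta> \<mu> (A, s A)" if "A \<in> Obj C" "P A" for A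
    by (intro EM_algebra_inverse_unit s that)
  have su: "h = s A" if "EM_algebra C T \<eta> \<mu> (A, h)" for A h
    using that EM_algebra_unique[OF that] alg[OF that] s by (auto simp: EM_algebra_def)
  have sm: "EM_morphism C T (A, s A) (B, s B) f" if "f \<in> hom_set C A B" "P A" "P B" for A B f
    by (intro EM_morphism_inverse_unit s that hom_objD[OF that(1)])
  define U :: "('o \<times> 'm, ('o \<times> 'm) \<times> 'm \<times> ('o \<times> 'm), 'o, 'm) fctr"
    where "U = \<lparr>on_obj = fst, on_mor = (\<lambda>(a, f, b). f)\<rparr>"
  define K :: "('o, 'm, 'o \<times> 'm, ('o \<times> 'm) \<times> 'm \<times> ('o \<times> 'm)) fctr"
    where "K = \<lparr>on_obj = (\<lambda>A. (A, s A)),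
    on_mor = (\<lambda>f. ((Dom C f, s (Dom C f)), f, (Cod C f, s (Cod C f))))\<rparr>"
  have homE: "f \<in> hom_set C A B" "P A" "P B" "A \<in> Obj C" "B \<in> Obj C"
    if "f \<in> hom_set ?S A B" for A B f
    using that T.C.dom_closed T.C.cod_closed by (auto simp: hom_set_def full_subcategory_def)
  have "is_functor ?E ?S U"
  proof (intro is_functor.intro category_EM category_full_subcategory T.C.category_axioms
      is_functor_axioms.intro)
    fix a assume "a \<in> Obj ?E"
    then show "on_obj U a \<in> Obj ?S"
      using alg by (cases a) (auto simp: EM_category_def U_def full_subcategory_def EM_algebra_def)
  qed (use alg in \<open>auto simp: EM_category_def U_def full_subcategory_def hom_set_def EM_morphism_def\<close>)
  moreover have "is_functor ?S ?E K"
  proof (intro is_functor.intro category_EM category_full_subcategory T.C.category_axioms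
      is_functor_axioms.intro)
    fix A assume "A \<in> Obj ?S"
    then show "on_obj K A \<in> Obj ?E"
      using sA by (auto simp: EM_category_def K_def full_subcategory_def)
  next
    fix f A B assume "f \<in> hom_set ?S A B"
    note f = homE[OF this]
    then show "on_mor K f \<in> hom_set ?E (on_obj K A) (on_obj K B)"
      using sm[OF f(1-3)] sA by (auto simp: EM_category_def K_def hom_set_def)
  next
    fix A assume "A \<in> Obj ?S"
    then show "on_mor K (Ide ?S A) = Ide ?E (on_obj K A)"
      using T.C.ide_hom by (auto simp: EM_category_def K_def full_subcategory_def hom_set_def)
  next
    fix f g X Y Z assume "f \<in> hom_set ?S X Y" "g \<in> hom_set ?S Y Z"
    then show "on_mor K (g \<odot>\<^bsub>?S\<^esub> f) = on_mor K g \<odot>\<^bsub>?E\<^esub> on_mor K f"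
      using homE(1) T.C.cmp_hom[of f X Y g Z]
      by (auto simp: EM_category_def K_def full_subcategory_def hom_set_def)
  qed
  ultimately show ?thesis
    unfolding isomorphic_categories_def
  proof (intro exI conjI ballI)
    fix a assume "a \<in> Obj ?E"
    then show "on_obj K (on_obj U a) = a"
      using su by (cases a) (auto simp: EM_category_def K_def U_def)
  next
    fix f assume "f \<in> Mor ?E"
    then show "on_mor K (on_mor U f) = f"
      using su by (auto simp: EM_category_def K_def U_def EM_morphism_def hom_set_def)
  qed (auto simp: K_def U_def)
qed

end

section \<open>Categories of structured sets\<close>

lemma concrete_category_hom:
  "f \<in> hom_set (concrete_category Ob car P) A B \<longleftrightarrow> A \<in> Ob \<and> B \<in> Ob \<and>
     source f = A \<and> target f = B \<and> fn f \<in> car A \<rightarrow>\<^sub>E car B \<and> P A B (fn f)"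
  by (cases f) (auto simp: hom_set_def concrete_category_def)

lemma concrete_category_simps:
  "Obj (concrete_category Ob car P) = Ob"
  "Ide (concrete_category Ob car P) A = Arrow A (\<lambda>x\<in>car A. x) A"
  "Cmp (concrete_category Ob car P) g f
     = Arrow (source f) (compose (car (source f)) (fn g) (fn f)) (target g)"
  by (simp_all add: concrete_category_def)

lemma compose_PiE:
  "f \<in> A \<rightarrow>\<^sub>E B \<Longrightarrow> g \<in> B \<rightarrow>\<^sub>E C \<Longrightarrow> compose A g f \<in> A \<rightarrow>\<^sub>E C"
  by (auto simp: compose_def)

lemma category_concrete:
  assumes id: "\<And>A. A \<in> Ob \<Longrightarrow> P A A (\<lambda>x\<in>car A. x)"
    and comp: "\<And>X Y Z f g. \<lbrakk>X \<in> Ob; Y \<in> Ob; Z \<in> Ob; f \<in> car X \<rightarrow>\<^sub>E car Y; g \<in> car Y \<rightarrow>\<^sub>E car Z;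
      P X Y f; P Y Z g\<rbrakk> \<Longrightarrow> P X Z (compose (car X) g f)"
  shows "category (concrete_category Ob car P)" (is "category ?C")
proof
  fix f assume "f \<in> Mor ?C"
  then show "Dom ?C f \<in> Obj ?C" "Cod ?C f \<in> Obj ?C" by (auto simp: concrete_category_def)
next
  fix A assume "A \<in> Obj ?C"
  then show "Ide ?C A \<in> hom_set ?C A A"
    by (simp add: concrete_category_hom concrete_category_simps id)
next
  fix f g X Y Z assume "f \<in> hom_set ?C X Y" "g \<in> hom_set ?C Y Z"
  then show "Cmp ?C g f \<in> hom_set ?C X Z"
    using comp[of X Y Z "fn f" "fn g"] compose_PiE[of "fn f" "car X" "car Y" "fn g" "car Z"]
    by (auto simp: concrete_category_hom concrete_category_simps)
next
  fix f X Y assume "f \<in> hom_set ?C X Y"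
  then show "Cmp ?C f (Ide ?C X) = f"
    by (cases f) (auto simp: concrete_category_hom concrete_category_simps compose_def fun_eq_iff
        PiE_def extensional_def)
next
  fix f X Y assume "f \<in> hom_set ?C X Y"
  then show "Cmp ?C (Ide ?C Y) f = f"
    by (cases f) (auto simp: concrete_category_hom concrete_category_simps compose_def fun_eq_iff
        PiE_def extensional_def)
next
  fix f g h W X Y Z
  assume "f \<in> hom_set ?C W X" "g \<in> hom_set ?C X Y" "h \<in> hom_set ?C Y Z"
  then show "Cmp ?C (Cmp ?C h g) f = Cmp ?C h (Cmp ?C g f)"
    by (auto simp: concrete_category_hom concrete_category_simps compose_def fun_eq_iff)
qed

section \<open>Closure, loops and rank-1 flats\<close>

context
  fixes M :: "'e pmatroid"
  assumes M: "is_matroid M"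
begin

lemma finite_ground: "finite (ground M)"
  and flats_subset: "F \<in> flats M \<Longrightarrow> F \<subseteq> ground M"
  and ground_flat: "ground M \<in> flats M"
  and inter_flat: "F \<in> flats M \<Longrightarrow> K \<in> flats M \<Longrightarrow> F \<inter> K \<in> flats M"
  and unique_cover: "F \<in> flats M \<Longrightarrow> x \<in> ground M \<Longrightarrow> x \<notin> F \<Longrightarrow> \<exists>!F'. covers_flat M F F' \<and> x \<in> F'"
  using M unfolding is_matroid_def by auto

lemma finite_flats: "finite (flats M)"
  using M finite_ground by (auto simp: is_matroid_def intro: finite_subset)

lemma finite_flat: "F \<in> flats M \<Longrightarrow> finite F"
  using flats_subset finite_ground finite_subset by blast

lemma Inter_flats:
  assumes "\<F> \<subseteq> flats M" "\<F> \<noteq> {}"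
  shows "\<Inter>\<F> \<in> flats M"
proof -
  have "finite \<F>" using assms(1) finite_flats finite_subset by blast
  then show ?thesis
    using assms(2,1)
  proof (induction \<F> rule: finite_ne_induct)
    case (insert F \<F>)
    then show ?case using inter_flat[of F "\<Inter>\<F>"] by simp
  qed simp
qed

lemma cl_flat: "X \<subseteq> ground M \<Longrightarrow> cl M X \<in> flats M"
  unfolding cl_def using ground_flat by (intro Inter_flats) auto

lemma cl_superset: "X \<subseteq> cl M X"
  by (auto simp: cl_def)

lemma cl_least: "F \<in> flats M \<Longrightarrow> X \<subseteq> F \<Longrightarrow> cl M X \<subseteq> F"
  by (auto simp: cl_def)

lemma cl_subset_iff: "F \<in> flats M \<Longrightarrow> cl M X \<subseteq> F \<longleftrightarrow> X \<subseteq> F"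
  using cl_least cl_superset by blast

lemma cl_of_flat: "F \<in> flats M \<Longrightarrow> cl M F = F"
  using cl_least cl_superset by blast

lemma cl_mono: "X \<subseteq> Y \<Longrightarrow> cl M X \<subseteq> cl M Y"
  by (auto simp: cl_def)

lemma cl_eqI:
  assumes "X \<subseteq> ground M" "Y \<subseteq> ground M"
    and "\<And>F. F \<in> flats M \<Longrightarrow> X \<subseteq> F \<longleftrightarrow> Y \<subseteq> F"
  shows "cl M X = cl M Y"
  unfolding cl_def using assms(3) by auto

lemma cl_subset_ground: "X \<subseteq> ground M \<Longrightarrow> cl M X \<subseteq> ground M"
  using cl_flat flats_subset by blast

lemma cl_cl_Un: 
  assumes "X \<subseteq> ground M" "Y \<subseteq> ground M"
  shows "cl M (cl M X \<union> Y) = cl M (X \<union> Y)"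
  using assms cl_subset_ground[OF assms(1)] by (intro cl_eqI) (auto simp: cl_subset_iff)

text \<open>The cover of \<open>F\<close> through \<open>x\<close> that the axioms provide has no flat strictly between it and
  \<open>F\<close>, and the closure of \<open>insert x F\<close> is sandwiched in there.\<close>

lemma cl_insert_covers:
  assumes F: "F \<in> flats M" and x: "x \<in> ground M" "x \<notin> F"
  shows "covers_flat M F (cl M (insert x F))"
proof -
  obtain F' where F': "covers_flat M F F'" "x \<in> F'" using unique_cover[OF F x] by blast
  then have "F' \<in> flats M" "insert x F \<subseteq> F'" by (auto simp: covers_flat_def)
  then have "cl M (insert x F) \<subseteq> F'" by (rule cl_least)
  moreover have "cl M (insert x F) \<in> flats M" using cl_flat x flats_subset[OF F] by simp
  moreover have "F \<subset> cl M (insert x F)" using cl_superset[of "insert x F"] x by blast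
  ultimately have "cl M (insert x F) = F'" using F' by (auto simp: covers_flat_def)
  with F' show ?thesis by simp
qed

lemma loop_iff: "loop M x \<longleftrightarrow> x \<in> cl M {}"
  using ground_flat by (auto simp: loop_def cl_def)

lemma nonloop_iff: "nonloop M x \<longleftrightarrow> x \<in> ground M \<and> x \<notin> cl M {}"
  by (auto simp: nonloop_def loop_iff)

lemma cl_loop: "loop M x \<Longrightarrow> cl M {x} = cl M {}"
  by (rule cl_eqI) (auto simp: loop_def)

lemma nonloop_covers: "nonloop M x \<Longrightarrow> covers_flat M (cl M {}) (cl M {x})"
  using cl_insert_covers[of "cl M {}" x] cl_cl_Un[of "{}" "{x}"] cl_flat[of "{}"]
  by (simp add: nonloop_iff)

text \<open>No flat lies strictly between the flat of loops and \<open>cl M {x}\<close>, but \<open>cl M {y}\<close> is strictly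
  above the former and below the latter.\<close>

lemma cl_nonloop_eq:
  assumes "nonloop M x" "nonloop M y" "y \<in> cl M {x}"
  shows "cl M {y} = cl M {x}"
proof -
  have "cl M {y} \<in> flats M" using assms(2) by (simp add: cl_flat nonloop_iff)
  moreover have "cl M {y} \<subseteq> cl M {x}"
    using assms by (intro cl_least) (auto simp: cl_flat nonloop_iff)
  moreover have "cl M {} \<subset> cl M {y}" using nonloop_covers[OF assms(2)] by (simp add: covers_flat_def)
  ultimately show ?thesis
    using nonloop_covers[OF assms(1)] by (auto simp: covers_flat_def)
qed

lemma indep_finite: "finite {I. indep M I \<and> I \<subseteq> X}"
  using finite_ground by (rule finite_subset[rotated, OF finite_Pow_iff[THEN iffD2]])
    (auto simp: indep_def)

lemma indep_nonloop: "indep M I \<Longrightarrow> x \<in> I \<Longrightarrow> nonloop M x"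
  using cl_mono[of "{}" "I - {x}"] by (auto simp: indep_def nonloop_iff)

lemma indep_singleton: "nonloop M x \<Longrightarrow> indep M {x}"
  by (simp add: indep_def nonloop_iff)

lemma rank_le_iff: "rank M X \<le> n \<longleftrightarrow> (\<forall>I. indep M I \<and> I \<subseteq> X \<longrightarrow> card I \<le> n)"
proof -
  have "indep M {} \<and> {} \<subseteq> X" by (simp add: indep_def)
  then have ne: "card ` {I. indep M I \<and> I \<subseteq> X} \<noteq> {}" by blast
  show ?thesis
    unfolding rank_def using indep_finite ne by (subst Max_le_iff) auto
qed

text \<open>Two distinct nonloops \<open>x\<close>, \<open>y\<close> are dependent iff they have the same closure. So a flat of rank
  1 lies in the closure of any of its nonloops, and conversely such a closure contains no independent
  pair. This removes \<^const>\<open>rank\<close> and \<^const>\<open>indep\<close> from the rest of the argument.\<close>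

lemma rank1_flat_iff: "rank1_flat M F \<longleftrightarrow> (\<exists>x. nonloop M x \<and> F = cl M {x})"
proof
  assume F: "rank1_flat M F"
  then have "\<not> rank M F \<le> 0" by (simp add: rank1_flat_def)
  then obtain I where I: "indep M I" "I \<subseteq> F" "I \<noteq> {}"
    unfolding rank_le_iff by (metis card.empty order_refl)
  then obtain x where x: "x \<in> F" "nonloop M x" using indep_nonloop by blast
  have "y \<in> cl M {x}" if y: "y \<in> F" for y
  proof (rule ccontr)
    assume n: "y \<notin> cl M {x}"
    have yg: "nonloop M y"
      using n y F flats_subset cl_mono[of "{}" "{x}"] by (auto simp: nonloop_iff rank1_flat_def)
    have "x \<notin> cl M {y}" using cl_nonloop_eq[OF yg x(2)] n cl_superset[of "{y}"] by auto
    moreover have "x \<noteq> y" using n cl_superset[of "{x}"] by auto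
    ultimately have "indep M {x, y}" using n x yg
      by (auto simp: indep_def nonloop_iff insert_Diff_if)
    then have "card {x, y} \<le> rank M F" using rank_le_iff[of F "rank M F"] x y by auto
    then show False using F \<open>x \<noteq> y\<close> by (simp add: rank1_flat_def)
  qed
  moreover have "cl M {x} \<subseteq> F" using F x by (intro cl_least) (auto simp: rank1_flat_def)
  ultimately show "\<exists>x. nonloop M x \<and> F = cl M {x}" using x by blast
next
  assume "\<exists>x. nonloop M x \<and> F = cl M {x}"
  then obtain x where x: "nonloop M x" "F = cl M {x}" by blast
  have "card I \<le> 1" if I: "indep M I" "I \<subseteq> F" for I
  proof -
    have "y = z" if "y \<in> I" "z \<in> I" for y z
    proof (rule ccontr)
      assume "y \<noteq> z"
      then have "{z} \<subseteq> I - {y}" using that by auto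
      then have "y \<notin> cl M {z}" using cl_mono[of "{z}" "I - {y}"] I(1) that by (auto simp: indep_def)
      moreover have "cl M {z} = cl M {x}" "y \<in> cl M {x}"
        using cl_nonloop_eq[OF x(1)] indep_nonloop[OF I(1)] that I(2) x(2) by auto
      ultimately show False by simp
    qed
    moreover have "finite I" using I(1) finite_ground finite_subset by (auto simp: indep_def)
    ultimately show ?thesis by (auto simp: card_le_Suc0_iff_eq)
  qed
  then have "rank M F \<le> 1" by (simp add: rank_le_iff)
  moreover have "\<not> rank M F \<le> 0"
    using x indep_singleton[OF x(1)] cl_superset[of "{x}"] rank_le_iff[of F 0] by auto
  ultimately have "rank M F = 1" by simp
  then show "rank1_flat M F"
    using x by (simp add: rank1_flat_def cl_flat nonloop_iff)
qed

lemma parallel_iff: "parallel M x y \<longleftrightarrow> nonloop M x \<and> nonloop M y \<and> cl M {x} = cl M {y}"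
proof
  assume "parallel M x y"
  then obtain z where "nonloop M x" "nonloop M y" "nonloop M z" "x \<in> cl M {z}" "y \<in> cl M {z}"
    by (auto simp: parallel_def rank1_flat_iff)
  then show "nonloop M x \<and> nonloop M y \<and> cl M {x} = cl M {y}"
    using cl_nonloop_eq by metis
next
  assume "nonloop M x \<and> nonloop M y \<and> cl M {x} = cl M {y}"
  then show "parallel M x y"
    using cl_superset[of "{x}"] cl_superset[of "{y}"] by (auto simp: parallel_def rank1_flat_iff)
qed

end

lemma strong_map_cl:
  assumes N: "is_matroid N" and f: "strong_map M N f" and X: "X \<subseteq> ground M"
  shows "f ` cl M X \<subseteq> cl N (f ` X)"
proof -
  have "f ` X \<subseteq> ground N" using f X by (auto simp: strong_map_def)
  then have "{x \<in> ground M. f x \<in> cl N (f ` X)} \<in> flats M"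
    using f cl_flat[OF N] by (auto simp: strong_map_def)
  moreover have "X \<subseteq> {x \<in> ground M. f x \<in> cl N (f ` X)}"
    using X cl_superset[OF N, of "f ` X"] by auto
  ultimately show ?thesis by (auto simp: cl_def[of M])
qed

lemma cl_image_cl:
  assumes M: "is_matroid M" and N: "is_matroid N" and f: "strong_map M N f" and X: "X \<subseteq> ground M"
  shows "cl N (f ` cl M X) = cl N (f ` X)"
proof (rule cl_eqI[OF N])
  have *: "f ` ground M \<subseteq> ground N" using f by (simp add: strong_map_def)
  show "f ` X \<subseteq> ground N" "f ` cl M X \<subseteq> ground N"
    using * X cl_subset_ground[OF M X] by blast+
  show "f ` cl M X \<subseteq> F \<longleftrightarrow> f ` X \<subseteq> F" if "F \<in> flats N" for F
    using strong_map_cl[OF N f X] cl_superset[OF M, of X] cl_subset_iff[OF N that, of "f ` X"]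
    by blast
qed

lemma strong_map_loop: "strong_map M N f \<Longrightarrow> loop M x \<Longrightarrow> loop N (f x)"
  by (auto simp: strong_map_def loop_def)

text \<open>Pulling the flats back along a surjection keeps the lattice of flats, and so the covering
  relation, unchanged; only loops and parallel elements can be added.\<close>

lemma is_matroid_pullback:
  assumes N: "is_matroid N" and fin: "finite (ground M)" and f: "f ` ground M = ground N"
    and fl: "flats M = (\<lambda>F. {x \<in> ground M. f x \<in> F}) ` flats N"
  shows "is_matroid M"
proof -
  define p where "p = (\<lambda>F. {x \<in> ground M. f x \<in> F})"
  have fl: "flats M = p ` flats N" unfolding p_def by (rule fl)
  have p_le: "p F \<subseteq> p K \<longleftrightarrow> F \<subseteq> K" if "F \<in> flats N" for F K
  proof
    assume le: "p F \<subseteq> p K"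
    have Fg: "F \<subseteq> ground N" by (rule flats_subset[OF N that])
    show "F \<subseteq> K"
    proof
      fix y assume "y \<in> F"
      moreover from this obtain x where "x \<in> ground M" "y = f x"
        using Fg f by blast
      ultimately show "y \<in> K" using le by (auto simp: p_def)
    qed
  qed (auto simp: p_def)
  have p_eq: "p F = p K \<longleftrightarrow> F = K" if "F \<in> flats N" "K \<in> flats N" for F K
    using p_le[of F K] p_le[of K F] that by auto
  have p_less: "p F \<subset> p K \<longleftrightarrow> F \<subset> K" if "F \<in> flats N" "K \<in> flats N" for F K
    using p_le[of F K] p_eq[of F K] that by (simp add: psubset_eq)
  have cov: "covers_flat M (p F) (p K) \<longleftrightarrow> covers_flat N F K"
    if "F \<in> flats N" "K \<in> flats N" for F K
    using that p_less by (simp add: covers_flat_def fl)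
  have mem: "x \<in> p F \<longleftrightarrow> f x \<in> F" if "x \<in> ground M" for x F using that by (simp add: p_def)
  show ?thesis
    unfolding is_matroid_def
  proof (intro conjI ballI fin)
    show "flats M \<subseteq> Pow (ground M)" by (auto simp: fl p_def)
    have "ground M = p (ground N)" using f by (auto simp: p_def)
    then show "ground M \<in> flats M" using ground_flat[OF N] by (auto simp: fl)
  next
    fix F K assume "F \<in> flats M" "K \<in> flats M"
    then obtain F' K' where "F = p F'" "K = p K'" "F' \<in> flats N" "K' \<in> flats N" by (auto simp: fl)
    moreover from this have "F \<inter> K = p (F' \<inter> K')" by (auto simp: p_def)
    ultimately show "F \<inter> K \<in> flats M" using inter_flat[OF N] by (auto simp: fl)
  next
    fix F x assume "F \<in> flats M" and x: "x \<in> ground M - F"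
    then obtain F' where F': "F = p F'" "F' \<in> flats N" by (auto simp: fl)
    then have "f x \<in> ground N" "f x \<notin> F'" using x f by (auto simp: p_def)
    then have "\<exists>!K'. covers_flat N F' K' \<and> f x \<in> K'" using unique_cover[OF N F'(2)] by simp
    then obtain K' where K': "covers_flat N F' K'" "f x \<in> K'"
      and uniq: "\<And>L. covers_flat N F' L \<and> f x \<in> L \<Longrightarrow> L = K'" by auto
    have K'f: "K' \<in> flats N" using K' by (simp add: covers_flat_def)
    show "\<exists>!K. covers_flat M F K \<and> x \<in> K"
    proof (rule ex1I[of _ "p K'"])
      show "covers_flat M F (p K') \<and> x \<in> p K'"
        using K' K'f F' x by (simp add: cov mem)
      fix K assume K: "covers_flat M F K \<and> x \<in> K"
      then obtain L where L: "K = p L" "L \<in> flats N" by (auto simp: covers_flat_def fl)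
      then have "covers_flat N F' L \<and> f x \<in> L" using K F' x by (simp add: cov mem)
      then show "K = p K'" using uniq L by blast
    qed
  qed
qed

section \<open>Joins and atoms in a geometric lattice\<close>

lemma (in partial_order) sup_eqI: "least L s (Upper L A) \<Longrightarrow> \<Squnion>A = s"
  unfolding sup_def by (rule some_equality) (auto intro: least_unique)

lemma (in partial_order) inf_eqI: "greatest L s (Lower L A) \<Longrightarrow> \<Sqinter>A = s"
  unfolding inf_def by (rule some_equality) (auto intro: greatest_unique)

lemma (in partial_order) bottom_eqI: "least L b (carrier L) \<Longrightarrow> \<bottom> = b"
  unfolding bottom_def by (rule some_equality) (auto intro: least_unique)

context
  fixes G :: "'l gorder" (structure)
  assumes G: "geometric_lattice G"
begin

interpretation bounded_lattice G
  using G by (simp add: geometric_lattice_def)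

lemma glat_refl: "x \<in> carrier G \<Longrightarrow> x \<sqsubseteq> x"
  by simp

lemma glat_trans: "x \<sqsubseteq> y \<Longrightarrow> y \<sqsubseteq> z \<Longrightarrow> x \<in> carrier G \<Longrightarrow> y \<in> carrier G \<Longrightarrow> z \<in> carrier G \<Longrightarrow> x \<sqsubseteq> z"
  by (rule le_trans)

lemma glat_antisym: "x \<sqsubseteq> y \<Longrightarrow> y \<sqsubseteq> x \<Longrightarrow> x \<in> carrier G \<Longrightarrow> y \<in> carrier G \<Longrightarrow> x = y"
  by (rule le_antisym)

lemma glat_less_iff: "x \<sqsubset> y \<longleftrightarrow> x \<sqsubseteq> y \<and> x \<noteq> y"
  by (simp add: lless_def eq_is_equal)

lemma glat_bot: "\<bottom> \<in> carrier G" "x \<in> carrier G \<Longrightarrow> \<bottom> \<sqsubseteq> x"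
  using bottom_least by (auto simp: least_def)

lemma finite_carrier: "finite (carrier G)"
  using G by (simp add: geometric_lattice_def)

lemma sup_least:
  assumes A: "A \<subseteq> carrier G"
  shows "least G (\<Squnion>A) (Upper G A)"
proof (cases "A = {}")
  case True
  have "least G \<bottom> (Upper G {})" using bottom_least by (simp add: Upper_empty)
  with True show ?thesis using sup_eqI by metis
next
  case False
  then show ?thesis
    using finite_sup_least[OF _ A] finite_carrier finite_subset[OF A] by simp
qed

lemma glat_sup_closed: "A \<subseteq> carrier G \<Longrightarrow> \<Squnion>A \<in> carrier G"
  using sup_least[of A] by (auto simp: least_def Upper_def)

lemma glat_sup_le_iff:
  assumes "A \<subseteq> carrier G" "z \<in> carrier G"
  shows "\<Squnion>A \<sqsubseteq> z \<longleftrightarrow> (\<forall>a \<in> A. a \<sqsubseteq> z)"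
proof
  assume *: "\<Squnion>A \<sqsubseteq> z"
  show "\<forall>a \<in> A. a \<sqsubseteq> z"
  proof
    fix a assume "a \<in> A"
    then have "a \<sqsubseteq> \<Squnion>A" using sup_least[OF assms(1)] assms by (auto simp: least_def Upper_def)
    then show "a \<sqsubseteq> z"
      using * \<open>a \<in> A\<close> assms glat_sup_closed[OF assms(1)] by (auto intro: glat_trans[of a "\<Squnion>A"])
  qed
next
  assume "\<forall>a \<in> A. a \<sqsubseteq> z"
  then show "\<Squnion>A \<sqsubseteq> z" using sup_least[OF assms(1)] assms by (auto simp: least_def Upper_def)
qed

lemma glat_sup_eqI:
  assumes "A \<subseteq> carrier G" "x \<in> carrier G" "\<And>z. z \<in> carrier G \<Longrightarrow> x \<sqsubseteq> z \<longleftrightarrow> (\<forall>a \<in> A. a \<sqsubseteq> z)"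
  shows "\<Squnion>A = x"
proof (rule glat_antisym)
  show c: "\<Squnion>A \<in> carrier G" by (rule glat_sup_closed[OF assms(1)])
  show "\<Squnion>A \<sqsubseteq> x" using assms(3)[OF assms(2)] glat_sup_le_iff[OF assms(1,2)] assms(2) by simp
  show "x \<sqsubseteq> \<Squnion>A" using assms(3)[OF c] glat_sup_le_iff[OF assms(1) c] c by simp
qed (rule assms(2))

lemma glat_sup_empty: "\<Squnion>{} = \<bottom>"
  by (rule glat_sup_eqI) (auto simp: glat_bot)

lemma atom_iff: "a \<in> atoms G \<longleftrightarrow> a \<in> carrier G \<and> a \<noteq> \<bottom> \<and>
    (\<forall>z \<in> carrier G. z \<sqsubseteq> a \<longrightarrow> z = \<bottom> \<or> z = a)"
  using glat_bot by (auto simp: atoms_def lcovers_def glat_less_iff)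

lemma atoms_carrier: "atoms G \<subseteq> carrier G"
  by (auto simp: atom_iff)

lemma finite_atoms: "finite (atoms G)"
  using finite_subset[OF atoms_carrier finite_carrier] .

lemma atom_not_le_bot: "a \<in> atoms G \<Longrightarrow> \<not> a \<sqsubseteq> \<bottom>"
  using glat_bot glat_antisym[of a \<bottom>] by (auto simp: atom_iff)

lemma atomistic:
  assumes x: "x \<in> carrier G" shows "\<Squnion>{a \<in> atoms G. a \<sqsubseteq> x} = x"
proof -
  obtain A where A: "A \<subseteq> atoms G" "x = \<Squnion>A"
    using G x by (auto simp: geometric_lattice_def)
  then have Ac: "A \<subseteq> carrier G" using atoms_carrier by blast
  have le: "a \<sqsubseteq> x" if "a \<in> A" for a using glat_sup_le_iff[OF Ac x] A(2) x that by simp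
  show ?thesis
  proof (rule glat_sup_eqI)
    fix z assume z: "z \<in> carrier G"
    show "x \<sqsubseteq> z \<longleftrightarrow> (\<forall>a \<in> {a \<in> atoms G. a \<sqsubseteq> x}. a \<sqsubseteq> z)"
    proof
      assume "x \<sqsubseteq> z"
      then show "\<forall>a \<in> {a \<in> atoms G. a \<sqsubseteq> x}. a \<sqsubseteq> z"
        using z x atoms_carrier by (auto intro: glat_trans[of _ x])
    next
      assume "\<forall>a \<in> {a \<in> atoms G. a \<sqsubseteq> x}. a \<sqsubseteq> z"
      then have "\<forall>a \<in> A. a \<sqsubseteq> z" using A(1) le by auto
      then show "x \<sqsubseteq> z" using glat_sup_le_iff[OF Ac z] A(2) by simp
    qed
  qed (use x atoms_carrier in auto)
qed

lemma le_iff_atoms_le: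
  assumes "x \<in> carrier G" "y \<in> carrier G"
  shows "x \<sqsubseteq> y \<longleftrightarrow> (\<forall>a \<in> atoms G. a \<sqsubseteq> x \<longrightarrow> a \<sqsubseteq> y)"
proof -
  have "{a \<in> atoms G. a \<sqsubseteq> x} \<subseteq> carrier G" using atoms_carrier by blast
  from glat_sup_le_iff[OF this assms(2)] show ?thesis
    unfolding atomistic[OF assms(1)] by blast
qed

lemma glat_meet:
  assumes "x \<in> carrier G" "y \<in> carrier G"
  shows "x \<sqinter> y \<in> carrier G" "z \<in> carrier G \<Longrightarrow> z \<sqsubseteq> x \<sqinter> y \<longleftrightarrow> z \<sqsubseteq> x \<and> z \<sqsubseteq> y"
proof -
  show c: "x \<sqinter> y \<in> carrier G" using assms by simp
  assume z: "z \<in> carrier G"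
  show "z \<sqsubseteq> x \<sqinter> y \<longleftrightarrow> z \<sqsubseteq> x \<and> z \<sqsubseteq> y"
    using meet_le[of z x y] meet_left[OF assms] meet_right[OF assms]
      glat_trans[OF _ _ z c assms(1)] glat_trans[OF _ _ z c assms(2)] assms z by metis
qed

text \<open>An atom \<open>a\<close> that is not below \<open>x\<close> meets \<open>x\<close> in the bottom element, which \<open>a\<close> covers; so
  semimodularity applies.\<close>

lemma join_atom_covers:
  assumes a: "a \<in> atoms G" and x: "x \<in> carrier G" and n: "\<not> a \<sqsubseteq> x"
  shows "lcovers G x (\<Squnion>{a, x})"
proof -
  have ac: "a \<in> carrier G" using a atoms_carrier by blast
  have m: "a \<sqinter> x \<in> carrier G" "a \<sqinter> x \<sqsubseteq> a" "a \<sqinter> x \<sqsubseteq> x"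
    using glat_meet(1)[OF ac x] meet_left[OF ac x] meet_right[OF ac x] by blast+
  have "a \<sqinter> x \<noteq> a" using m n by metis
  then have "a \<sqinter> x = \<bottom>" using a m unfolding atom_iff by blast
  then have "lcovers G (a \<sqinter> x) a" using a by (simp add: atoms_def)
  moreover have "lcovers G (a \<sqinter> x) a \<longrightarrow> lcovers G x (a \<squnion> x)"
    using G ac x unfolding geometric_lattice_def by blast
  ultimately have "lcovers G x (a \<squnion> x)" by blast
  then show ?thesis unfolding join_def .
qed

end

section \<open>The lattice of flats is geometric\<close>

context
  fixes M :: "'a matr"
  assumes M: "is_matroid M"
begin

lemma carrier_L: "F \<in> carrier (L_obj M) \<longleftrightarrow> fset F \<in> flats M"
  by (simp add: L_obj_def)

lemma le_L: "F \<sqsubseteq>\<^bsub>L_obj M\<^esub> K \<longleftrightarrow> fset F \<subseteq> fset K"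
  by (simp add: L_obj_def less_eq_fset.rep_eq)

lemma fset_flat: "F \<in> flats M \<Longrightarrow> fset (Abs_fset F) = F"
  using finite_flat[OF M] by (simp add: Abs_fset_inverse)

lemma fset_cl: "X \<subseteq> ground M \<Longrightarrow> fset (Abs_fset (cl M X)) = cl M X"
  by (rule fset_flat[OF cl_flat[OF M]])

lemma carrier_L_ground: "F \<in> carrier (L_obj M) \<Longrightarrow> fset F \<subseteq> ground M"
  using flats_subset[OF M] by (simp add: carrier_L)

lemma L_partial_order: "partial_order (L_obj M)"
  by unfold_locales (auto simp: L_obj_def less_eq_fset.rep_eq fset_inject)

lemma L_least_sup:
  assumes A: "\<A> \<subseteq> carrier (L_obj M)"
  shows "least (L_obj M) (Abs_fset (cl M (\<Union>(fset ` \<A>)))) (Upper (L_obj M) \<A>)"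
proof -
  have g: "\<Union>(fset ` \<A>) \<subseteq> ground M" using A carrier_L_ground by blast
  have "fset F \<subseteq> cl M (\<Union>(fset ` \<A>))" if "F \<in> \<A>" for F
    using cl_superset[OF M, of "\<Union>(fset ` \<A>)"] that by blast
  moreover have "cl M (\<Union>(fset ` \<A>)) \<subseteq> fset K" if "K \<in> carrier (L_obj M)" "\<And>F. F \<in> \<A> \<Longrightarrow> fset F \<subseteq> fset K" for K
    using that by (intro cl_least[OF M]) (auto simp: carrier_L)
  moreover have "Abs_fset (cl M (\<Union>(fset ` \<A>))) \<in> carrier (L_obj M)"
    by (simp add: carrier_L fset_cl[OF g] cl_flat[OF M g])
  ultimately show ?thesis
    unfolding least_def Upper_def Int_absorb2[OF A] by (simp add: le_L fset_cl[OF g])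
qed

lemma L_sup:
  assumes A: "\<A> \<subseteq> carrier (L_obj M)"
  shows "fset (\<Squnion>\<^bsub>L_obj M\<^esub> \<A>) = cl M (\<Union>(fset ` \<A>))"
proof -
  have "\<Union>(fset ` \<A>) \<subseteq> ground M" using A carrier_L_ground by blast
  then show ?thesis
    using partial_order.sup_eqI[OF L_partial_order L_least_sup[OF A]] by (simp add: fset_cl)
qed

lemma L_greatest_inf:
  assumes "F \<in> carrier (L_obj M)" "K \<in> carrier (L_obj M)"
  shows "greatest (L_obj M) (F |\<inter>| K) (Lower (L_obj M) {F, K})"
  using assms inter_flat[OF M] by (auto simp: greatest_def Lower_def carrier_L le_L)

lemma L_meet:
  assumes "F \<in> carrier (L_obj M)" "K \<in> carrier (L_obj M)"
  shows "F \<sqinter>\<^bsub>L_obj M\<^esub> K = F |\<inter>| K"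
  unfolding meet_def by (rule partial_order.inf_eqI[OF L_partial_order L_greatest_inf[OF assms]])

lemma L_least_bottom: "least (L_obj M) (Abs_fset (cl M {})) (carrier (L_obj M))"
  using cl_least[OF M] cl_flat[OF M]
  by (auto simp: least_def carrier_L le_L fset_cl)

lemma L_bottom: "fset \<bottom>\<^bsub>L_obj M\<^esub> = cl M {}"
  using partial_order.bottom_eqI[OF L_partial_order L_least_bottom] by (simp add: fset_cl)

lemma L_less: "F \<sqsubset>\<^bsub>L_obj M\<^esub> K \<longleftrightarrow> fset F \<subset> fset K"
  by (auto simp: lless_def le_L fset_inject) (auto simp: L_obj_def)

lemma L_covers:
  "lcovers (L_obj M) F K \<longleftrightarrow> covers_flat M (fset F) (fset K)"
proof -
  have flats: "flats M = fset ` carrier (L_obj M)"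
  proof (intro equalityI subsetI)
    fix H assume "H \<in> flats M"
    then show "H \<in> fset ` carrier (L_obj M)"
      by (intro image_eqI[of _ _ "Abs_fset H"]) (simp_all add: fset_flat carrier_L)
  next
    fix H assume "H \<in> fset ` carrier (L_obj M)"
    then show "H \<in> flats M" by (elim imageE) (simp only: carrier_L)
  qed
  show ?thesis
    unfolding lcovers_def covers_flat_def L_less flats by (simp add: inj_image_mem_iff fset_inject inj_def)
qed

lemma L_atoms: "F \<in> atoms (L_obj M) \<longleftrightarrow> (\<exists>x. nonloop M x \<and> fset F = cl M {x})"
proof
  assume "F \<in> atoms (L_obj M)"
  then have c: "covers_flat M (cl M {}) (fset F)" by (simp add: atoms_def L_covers L_bottom)
  then obtain x where x: "x \<in> fset F" "x \<notin> cl M {}" by (auto simp: covers_flat_def)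
  then have n: "nonloop M x"
    using c flats_subset[OF M, of "fset F"] by (auto simp: nonloop_iff[OF M] covers_flat_def)
  have "cl M {x} \<in> flats M" "cl M {} \<subset> cl M {x}"
    using nonloop_covers[OF M n] by (simp_all add: covers_flat_def)
  then have "\<not> cl M {x} \<subset> fset F" using c unfolding covers_flat_def by blast
  moreover have "cl M {x} \<subseteq> fset F"
    using x c by (intro cl_least[OF M]) (simp_all add: covers_flat_def)
  ultimately have "fset F = cl M {x}" by blast
  with n show "\<exists>x. nonloop M x \<and> fset F = cl M {x}" by blast
next
  assume "\<exists>x. nonloop M x \<and> fset F = cl M {x}"
  then obtain x where "nonloop M x" "fset F = cl M {x}" by blast
  then show "F \<in> atoms (L_obj M)"
    using nonloop_covers[OF M, of x] by (simp add: atoms_def L_covers L_bottom)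
qed

lemma L_bounded_lattice: "bounded_lattice (L_obj M)"
proof -
  interpret partial_order "L_obj M" by (rule L_partial_order)
  show ?thesis
  proof unfold_locales
    fix F K assume "F \<in> carrier (L_obj M)" "K \<in> carrier (L_obj M)"
    then show "\<exists>s. least (L_obj M) s (Upper (L_obj M) {F, K})"
      "\<exists>s. greatest (L_obj M) s (Lower (L_obj M) {F, K})"
      using L_least_sup[of "{F, K}"] L_greatest_inf by blast+
  next
    show "\<exists>b. least (L_obj M) b (carrier (L_obj M))" using L_least_bottom by blast
    have "greatest (L_obj M) (Abs_fset (ground M)) (carrier (L_obj M))"
      using ground_flat[OF M] carrier_L_ground
      by (auto simp: greatest_def carrier_L le_L fset_flat)
    then show "\<exists>t. greatest (L_obj M) t (carrier (L_obj M))" by blast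
  qed
qed

text \<open>A flat is the join of the closures of its nonloops. For semimodularity let \<open>F\<close> cover
  \<open>F \<inter> K\<close> and pick \<open>x \<in> F - K\<close>. Then \<open>F\<close> lies in the flat covering \<open>K\<close> that contains \<open>x\<close>, since
  \<open>F\<close> intersected with that flat is strictly above \<open>F \<inter> K\<close>; so this flat is the join.\<close>

lemma L_geometric: "geometric_lattice (L_obj M)"
  unfolding geometric_lattice_def
proof (intro conjI ballI impI L_bounded_lattice)
  have "finite (fset ` carrier (L_obj M))"
    by (rule finite_subset[OF _ finite_flats[OF M]]) (auto simp: carrier_L)
  then show "finite (carrier (L_obj M))"
    by (rule finite_imageD) (simp add: inj_on_def fset_inject)
next
  fix F assume F: "F \<in> carrier (L_obj M)"
  define A where "A = {Abs_fset (cl M {x}) | x. nonloop M x \<and> x \<in> fset F}"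
  have fA: "fset (Abs_fset (cl M {x})) = cl M {x}" if "nonloop M x" for x
    using that by (simp add: fset_cl nonloop_iff[OF M])
  have A: "A \<subseteq> atoms (L_obj M)" using fA by (auto simp: A_def L_atoms)
  have Ac: "A \<subseteq> carrier (L_obj M)"
    using fA cl_flat[OF M] by (auto simp: A_def carrier_L nonloop_iff[OF M])
  have UA: "\<Union>(fset ` A) \<subseteq> ground M" using Ac carrier_L_ground by blast
  have "cl M (\<Union>(fset ` A)) = fset F"
  proof
    show "cl M (\<Union>(fset ` A)) \<subseteq> fset F"
    proof (rule cl_least[OF M])
      show "fset F \<in> flats M" using F by (simp add: carrier_L)
      then show "\<Union>(fset ` A) \<subseteq> fset F" 
        using fA cl_subset_iff[OF M, of "fset F"] by (auto simp: A_def)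
    qed
    show "fset F \<subseteq> cl M (\<Union>(fset ` A))"
    proof
      fix x assume x: "x \<in> fset F"
      show "x \<in> cl M (\<Union>(fset ` A))"
      proof (cases "loop M x")
        case True
        then show ?thesis
          using cl_flat[OF M UA] by (simp add: loop_def)
      next
        case False
        then have n: "nonloop M x" using x carrier_L_ground[OF F] by (auto simp: nonloop_def)
        then have "x \<in> fset (Abs_fset (cl M {x}))" using fA cl_superset[OF M, of "{x}"] by simp
        then show ?thesis using n x cl_superset[OF M, of "\<Union>(fset ` A)"] by (auto simp: A_def)
      qed
    qed
  qed
  then have "F = \<Squnion>\<^bsub>L_obj M\<^esub> A" by (simp add: L_sup[OF Ac] flip: fset_inject)
  then show "\<exists>A \<subseteq> atoms (L_obj M). F = \<Squnion>\<^bsub>L_obj M\<^esub> A" using A by blast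
next
  fix F K assume F: "F \<in> carrier (L_obj M)" and K: "K \<in> carrier (L_obj M)"
    and c: "lcovers (L_obj M) (F \<sqinter>\<^bsub>L_obj M\<^esub> K) F"
  have c: "covers_flat M (fset F \<inter> fset K) (fset F)"
    using c by (simp add: L_meet[OF F K] L_covers)
  then obtain x where x: "x \<in> fset F" "x \<notin> fset K" by (auto simp: covers_flat_def)
  define H where "H = cl M (insert x (fset K))"
  have Kf: "fset K \<in> flats M" and Ff: "fset F \<in> flats M" using F K by (simp_all add: carrier_L)
  have H: "covers_flat M (fset K) H"
    unfolding H_def using x carrier_L_ground[OF F] by (intro cl_insert_covers[OF M Kf]) auto
  then have Hf: "H \<in> flats M" "fset K \<subseteq> H" by (auto simp: covers_flat_def)
  have xH: "x \<in> H" using cl_superset[OF M, of "insert x (fset K)"] by (simp add: H_def)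
  have "fset F \<inter> fset K \<subset> fset F \<inter> H" using x xH Hf by auto
  then have "\<not> fset F \<inter> H \<subset> fset F"
    using c inter_flat[OF M Ff Hf(1)] by (auto simp: covers_flat_def)
  then have FH: "fset F \<subseteq> H" by blast
  have "cl M (fset F \<union> fset K) = H"
  proof
    show "cl M (fset F \<union> fset K) \<subseteq> H" using FH Hf by (intro cl_least[OF M]) auto
    show "H \<subseteq> cl M (fset F \<union> fset K)" unfolding H_def using x by (intro cl_mono[OF M]) auto
  qed
  moreover have "fset (F \<squnion>\<^bsub>L_obj M\<^esub> K) = cl M (fset F \<union> fset K)"
    unfolding join_def using F K by (subst L_sup) auto
  ultimately show "lcovers (L_obj M) K (F \<squnion>\<^bsub>L_obj M\<^esub> K)"
    using H by (simp add: L_covers)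
qed

end

section \<open>The matroid of atoms\<close>

text \<open>The flat of the matroid of atoms that corresponds to the lattice element \<open>x\<close>.\<close>

definition atom_flat :: "'a glat \<Rightarrow> 'a elt fset \<Rightarrow> 'a elt set" where
  "atom_flat G x = insert Bullet (Elem ` {a \<in> atoms G. a \<sqsubseteq>\<^bsub>G\<^esub> x})"

lemma Bullet_atom_flat: "Bullet \<in> atom_flat G x"
  by (simp add: atom_flat_def)

lemma Elem_atom_flat: "Elem a \<in> atom_flat G x \<longleftrightarrow> a \<in> atoms G \<and> a \<sqsubseteq>\<^bsub>G\<^esub> x"
  by (auto simp: atom_flat_def)

lemma ground_S: "ground (S_obj G) = insert Bullet (Elem ` atoms G)"
  and flats_S: "flats (S_obj G) = atom_flat G ` carrier G"
  and point_S: "point (S_obj G) = Bullet"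
  by (auto simp: S_obj_def atom_flat_def)

lemma atom_flat_ground: "atom_flat G x \<subseteq> ground (S_obj G)"
  by (auto simp: atom_flat_def ground_S)

context
  fixes G :: "'a glat"
  assumes G: "geometric_lattice G"
begin

lemma atom_flat_subset:
  "x \<in> carrier G \<Longrightarrow> y \<in> carrier G \<Longrightarrow> atom_flat G x \<subseteq> atom_flat G y \<longleftrightarrow> x \<sqsubseteq>\<^bsub>G\<^esub> y"
  unfolding le_iff_atoms_le[OF G] by (auto simp: atom_flat_def)

lemma atom_flat_inject:
  "x \<in> carrier G \<Longrightarrow> y \<in> carrier G \<Longrightarrow> atom_flat G x = atom_flat G y \<longleftrightarrow> x = y"
  using atom_flat_subset glat_antisym[OF G] by (metis order_refl)

lemma atom_flat_bottom: "atom_flat G \<bottom>\<^bsub>G\<^esub> = {Bullet}"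
  using atom_not_le_bot[OF G] by (auto simp: atom_flat_def)

lemma covers_atom_flat:
  assumes "x \<in> carrier G" "y \<in> carrier G"
  shows "covers_flat (S_obj G) (atom_flat G x) (atom_flat G y) \<longleftrightarrow> lcovers G x y"
proof -
  have "atom_flat G u \<subset> atom_flat G v \<longleftrightarrow> u \<sqsubset>\<^bsub>G\<^esub> v" if "u \<in> carrier G" "v \<in> carrier G" for u v
    using that by (simp add: psubset_eq atom_flat_subset atom_flat_inject glat_less_iff[OF G])
  then show ?thesis
    using assms by (simp add: covers_flat_def lcovers_def flats_S)
qed

text \<open>The flat covering \<open>x\<close> that contains an atom \<open>a\<close> not below \<open>x\<close> must be the join of \<open>a\<close> and
  \<open>x\<close>: that join covers \<open>x\<close> by semimodularity, and lies below every element above both.\<close>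

lemma S_is_matroid: "is_matroid (S_obj G)"
  unfolding is_matroid_def
proof (intro conjI ballI)
  show "finite (ground (S_obj G))" using finite_atoms[OF G] by (simp add: ground_S)
  show "flats (S_obj G) \<subseteq> Pow (ground (S_obj G))" using atom_flat_ground by (auto simp: flats_S)
  have t: "\<Squnion>\<^bsub>G\<^esub> (atoms G) \<in> carrier G" by (rule glat_sup_closed[OF G atoms_carrier[OF G]])
  moreover have "ground (S_obj G) = atom_flat G (\<Squnion>\<^bsub>G\<^esub> (atoms G))"
    using glat_sup_le_iff[OF G atoms_carrier[OF G] t] glat_refl[OF G t]
    by (auto simp: ground_S atom_flat_def)
  ultimately show "ground (S_obj G) \<in> flats (S_obj G)" by (simp add: flats_S)
next
  fix F K assume "F \<in> flats (S_obj G)" "K \<in> flats (S_obj G)"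
  then obtain x y where xy: "x \<in> carrier G" "y \<in> carrier G" "F = atom_flat G x" "K = atom_flat G y"
    by (auto simp: flats_S)
  then have "F \<inter> K = atom_flat G (x \<sqinter>\<^bsub>G\<^esub> y)"
    using glat_meet(2)[OF G] atoms_carrier[OF G] by (auto simp: atom_flat_def)
  then show "F \<inter> K \<in> flats (S_obj G)" using xy glat_meet(1)[OF G] by (simp add: flats_S)
next
  fix F e assume "F \<in> flats (S_obj G)" and e: "e \<in> ground (S_obj G) - F"
  then obtain x where x: "x \<in> carrier G" "F = atom_flat G x" by (auto simp: flats_S)
  with e obtain a where a: "e = Elem a" "a \<in> atoms G" "\<not> a \<sqsubseteq>\<^bsub>G\<^esub> x"
    by (auto simp: ground_S atom_flat_def)
  then have ac: "a \<in> carrier G" using atoms_carrier[OF G] by blast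
  define j where "j = \<Squnion>\<^bsub>G\<^esub> {a, x}"
  have j: "j \<in> carrier G" and j_le: "\<And>z. z \<in> carrier G \<Longrightarrow> j \<sqsubseteq>\<^bsub>G\<^esub> z \<longleftrightarrow> a \<sqsubseteq>\<^bsub>G\<^esub> z \<and> x \<sqsubseteq>\<^bsub>G\<^esub> z"
    unfolding j_def using glat_sup_closed[OF G, of "{a, x}"] glat_sup_le_iff[OF G, of "{a, x}"] ac x
    by auto
  have cj: "lcovers G x j" unfolding j_def by (rule join_atom_covers[OF G a(2) x(1) a(3)])
  show "\<exists>!F'. covers_flat (S_obj G) F F' \<and> e \<in> F'"
  proof (rule ex1I[of _ "atom_flat G j"])
    show "covers_flat (S_obj G) F (atom_flat G j) \<and> e \<in> atom_flat G j"
      using cj j j_le[OF j] glat_refl[OF G j] a x by (simp add: covers_atom_flat Elem_atom_flat)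
  next
    fix F' assume F': "covers_flat (S_obj G) F F' \<and> e \<in> F'"
    then obtain z where z: "z \<in> carrier G" "F' = atom_flat G z"
      by (auto simp: covers_flat_def flats_S)
    then have cz: "lcovers G x z" and az: "a \<sqsubseteq>\<^bsub>G\<^esub> z"
      using F' x a by (auto simp: covers_atom_flat Elem_atom_flat)
    then have "j \<sqsubseteq>\<^bsub>G\<^esub> z" using z j_le by (simp add: lcovers_def glat_less_iff[OF G])
    moreover have "x \<sqsubset>\<^bsub>G\<^esub> j" using cj by (simp add: lcovers_def)
    ultimately have "j = z" using cz j by (auto simp: lcovers_def glat_less_iff[OF G])
    then show "F' = atom_flat G j" using z by simp
  qed
qed

text \<open>Closures in the matroid of atoms are joins; the universal property of the join is all that has to
  be checked to compute one.\<close>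

lemma cl_S_eqI:
  assumes y: "y \<in> carrier G" 
    and le: "\<And>z. z \<in> carrier G \<Longrightarrow> X \<subseteq> atom_flat G z \<longleftrightarrow> y \<sqsubseteq>\<^bsub>G\<^esub> z"
  shows "cl (S_obj G) X = atom_flat G y"
proof
  show "cl (S_obj G) X \<subseteq> atom_flat G y"
    using le[OF y] glat_refl[OF G y] y by (intro cl_least[OF S_is_matroid]) (auto simp: flats_S)
  show "atom_flat G y \<subseteq> cl (S_obj G) X"
  proof -
    have "atom_flat G y \<subseteq> F" if F: "F \<in> flats (S_obj G)" "X \<subseteq> F" for F
    proof -
      from F obtain z where "z \<in> carrier G" "F = atom_flat G z" by (auto simp: flats_S)
      then show ?thesis using F(2) le y by (simp add: atom_flat_subset)
    qed
    then show ?thesis unfolding cl_def by blast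
  qed
qed

lemma loop_S: "loop (S_obj G) e \<longleftrightarrow> e = Bullet"
  using glat_bot[OF G] cl_S_eqI[of "\<bottom>\<^bsub>G\<^esub>" "{}"]
  by (simp add: loop_iff[OF S_is_matroid] atom_flat_bottom)

lemma S_is_pointed: "is_pointed_matroid (S_obj G)"
  by (simp add: is_pointed_matroid_def S_is_matroid loop_S point_S)

lemma cl_S_atom: "a \<in> atoms G \<Longrightarrow> cl (S_obj G) {Elem a} = atom_flat G a"
  using atoms_carrier[OF G] by (intro cl_S_eqI) (auto simp: Elem_atom_flat)

lemma carrier_LS: "F \<in> carrier (L_obj (S_obj G)) \<longleftrightarrow> (\<exists>x \<in> carrier G. fset F = atom_flat G x)"
  by (auto simp: carrier_L[OF S_is_matroid] flats_S)

lemma atoms_LS: "F \<in> atoms (L_obj (S_obj G)) \<longleftrightarrow> (\<exists>a \<in> atoms G. fset F = atom_flat G a)"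
  unfolding L_atoms[OF S_is_matroid] by (auto simp: nonloop_def loop_S ground_S cl_S_atom)

end

section \<open>The categories and the two functors\<close>

lemma strong_map_cong:
  assumes "\<And>x. x \<in> ground M \<Longrightarrow> f x = g x"
  shows "strong_map M N f \<longleftrightarrow> strong_map M N g"
proof -
  have "{x \<in> ground M. f x \<in> F} = {x \<in> ground M. g x \<in> F}" for F using assms by auto
  moreover have "f ` ground M = g ` ground M" using assms by (rule image_cong[OF refl])
  ultimately show ?thesis by (simp add: strong_map_def)
qed

lemma strong_map_id: "is_matroid M \<Longrightarrow> strong_map M M (\<lambda>x. x)"
proof -
  assume M: "is_matroid M"
  have "{x \<in> ground M. x \<in> F} = F" if "F \<in> flats M" for F using flats_subset[OF M that] by blast
  then show ?thesis by (simp add: strong_map_def)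
qed

lemma strong_map_comp:
  assumes "strong_map M N f" "strong_map N K g"
  shows "strong_map M K (\<lambda>x. g (f x))"
  unfolding strong_map_def
proof (intro conjI ballI)
  show "(\<lambda>x. g (f x)) ` ground M \<subseteq> ground K"
    using assms unfolding strong_map_def by blast
next
  fix F assume "F \<in> flats K"
  then have "{y \<in> ground N. g y \<in> F} \<in> flats N"
    using assms(2) unfolding strong_map_def by blast
  then have "{x \<in> ground M. f x \<in> {y \<in> ground N. g y \<in> F}} \<in> flats M"
    using assms(1) unfolding strong_map_def by blast
  moreover have "{x \<in> ground M. f x \<in> {y \<in> ground N. g y \<in> F}} = {x \<in> ground M. g (f x) \<in> F}"
    using assms(1) unfolding strong_map_def by blast
  ultimately show "{x \<in> ground M. g (f x) \<in> F} \<in> flats M" by simp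
qed

lemma category_Matr: "category (Matr :: ('a matr, 'a matr_arrow) category)"
  unfolding Matr_def
proof (rule category_concrete, goal_cases)
  case (1 M)
  then show ?case
    using strong_map_id[of M] strong_map_cong[of M "\<lambda>x. x" "\<lambda>x\<in>ground M. x" M]
    by (simp add: is_pointed_matroid_def loop_def)
next
  case (2 M N K f g)
  then show ?case
    using strong_map_comp[of M N f K g]
      strong_map_cong[of M "\<lambda>x. g (f x)" "compose (ground M) g f" K]
    by (simp add: is_pointed_matroid_def loop_def compose_def)
qed

lemma glat_morphism_cong:
  assumes "geometric_lattice G" "\<And>x. x \<in> carrier G \<Longrightarrow> f x = g x"
  shows "glat_morphism G H f \<longleftrightarrow> glat_morphism G H g"
proof -
  have "f ` A = g ` A" if "A \<subseteq> carrier G" for A using that assms(2) by (auto intro!: image_cong)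
  moreover have "f (\<Squnion>\<^bsub>G\<^esub> A) = g (\<Squnion>\<^bsub>G\<^esub> A)" if "A \<subseteq> carrier G" for A
    using assms glat_sup_closed[OF _ that] by simp
  moreover have "f a = g a" if "a \<in> atoms G" for a using that assms atoms_carrier by blast
  ultimately show ?thesis by (simp add: glat_morphism_def)
qed

lemma glat_morphismD:
  assumes "glat_morphism G H f"
  shows "x \<in> carrier G \<Longrightarrow> f x \<in> carrier H" "A \<subseteq> carrier G \<Longrightarrow> f ` A \<subseteq> carrier H"
    "A \<subseteq> carrier G \<Longrightarrow> f (\<Squnion>\<^bsub>G\<^esub> A) = \<Squnion>\<^bsub>H\<^esub> (f ` A)"
    "a \<in> atoms G \<Longrightarrow> f a \<in> atoms H \<or> f a = \<bottom>\<^bsub>H\<^esub>"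
proof -
  from assms have "f ` carrier G \<subseteq> carrier H" by (simp add: glat_morphism_def)
  then show "x \<in> carrier G \<Longrightarrow> f x \<in> carrier H" "A \<subseteq> carrier G \<Longrightarrow> f ` A \<subseteq> carrier H" by blast+
  show "A \<subseteq> carrier G \<Longrightarrow> f (\<Squnion>\<^bsub>G\<^esub> A) = \<Squnion>\<^bsub>H\<^esub> (f ` A)"
    "a \<in> atoms G \<Longrightarrow> f a \<in> atoms H \<or> f a = \<bottom>\<^bsub>H\<^esub>"
    using assms by (simp_all add: glat_morphism_def)
qed

lemma glat_morphism_bottom:
  "geometric_lattice G \<Longrightarrow> geometric_lattice H \<Longrightarrow> glat_morphism G H f \<Longrightarrow> f \<bottom>\<^bsub>G\<^esub> = \<bottom>\<^bsub>H\<^esub>"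
  using glat_morphismD(3)[of G H f "{}"] glat_sup_empty[of G] glat_sup_empty[of H] by simp

lemma glat_morphism_comp:
  assumes H: "geometric_lattice H" and K: "geometric_lattice K"
    and f: "glat_morphism G H f" and g: "glat_morphism H K g"
  shows "glat_morphism G K (\<lambda>x. g (f x))"
  unfolding glat_morphism_def
proof (intro conjI allI impI ballI)
  show "(\<lambda>x. g (f x)) ` carrier G \<subseteq> carrier K"
    by (intro image_subsetI glat_morphismD(1)[OF g] glat_morphismD(1)[OF f])
next
  fix A assume A: "A \<subseteq> carrier G"
  show "g (f (\<Squnion>\<^bsub>G\<^esub> A)) = \<Squnion>\<^bsub>K\<^esub> ((\<lambda>x. g (f x)) ` A)"
    using glat_morphismD(3)[OF f A] glat_morphismD(3)[OF g glat_morphismD(2)[OF f A]]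
    by (simp add: image_image)
next
  fix a assume "a \<in> atoms G"
  from glat_morphismD(4)[OF f this] show "g (f a) \<in> atoms K \<or> g (f a) = \<bottom>\<^bsub>K\<^esub>"
    using glat_morphismD(4)[OF g, of "f a"] glat_morphism_bottom[OF H K g] by auto
qed

lemma glat_morphism_id: "glat_morphism G G (\<lambda>x. x)"
  by (simp add: glat_morphism_def)

lemma category_GLat: "category (GLat :: ('a glat, 'a glat_arrow) category)"
  unfolding GLat_def
proof (rule category_concrete, goal_cases)
  case (1 G)
  then show ?case
    using glat_morphism_id[of G] glat_morphism_cong[of G "\<lambda>x. x" "\<lambda>x\<in>carrier G. x" G] by simp
next
  case (2 G H K f g)
  then show ?case
    using glat_morphism_comp[of H K G f g]
      glat_morphism_cong[of G "\<lambda>x. g (f x)" "compose (carrier G) g f" K]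
    by (simp add: compose_def)
qed

lemma Obj_Matr: "Obj Matr = {M. is_pointed_matroid M}"
  and Obj_GLat: "Obj GLat = {G. geometric_lattice G}"
  by (simp_all add: Matr_def GLat_def concrete_category_simps)

lemma Matr_hom:
  "f \<in> hom_set Matr M N \<longleftrightarrow> is_pointed_matroid M \<and> is_pointed_matroid N \<and> source f = M \<and>
     target f = N \<and> fn f \<in> ground M \<rightarrow>\<^sub>E ground N \<and> strong_map M N (fn f) \<and> fn f (point M) = point N"
  by (auto simp: Matr_def concrete_category_hom)

lemma GLat_hom:
  "f \<in> hom_set GLat G H \<longleftrightarrow> geometric_lattice G \<and> geometric_lattice H \<and> source f = G \<and>
     target f = H \<and> fn f \<in> carrier G \<rightarrow>\<^sub>E carrier H \<and> glat_morphism G H (fn f)"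
  by (auto simp: GLat_def concrete_category_hom)

lemma arrow_eqI:
  "source f = source g \<Longrightarrow> target f = target g \<Longrightarrow> fn f \<in> A \<rightarrow>\<^sub>E B \<Longrightarrow> fn g \<in> A \<rightarrow>\<^sub>E B \<Longrightarrow>
    (\<And>x. x \<in> A \<Longrightarrow> fn f x = fn g x) \<Longrightarrow> f = g"
  by (cases f; cases g) (auto intro: PiE_ext)

lemma Matr_eqI:
  "f \<in> hom_set Matr M N \<Longrightarrow> g \<in> hom_set Matr M N \<Longrightarrow> (\<And>x. x \<in> ground M \<Longrightarrow> fn f x = fn g x) \<Longrightarrow> f = g"
  unfolding Matr_hom by (rule arrow_eqI[of f g "ground M" "ground N"]) auto

lemma GLat_eqI:
  "f \<in> hom_set GLat G H \<Longrightarrow> g \<in> hom_set GLat G H \<Longrightarrow> (\<And>x. x \<in> carrier G \<Longrightarrow> fn f x = fn g x) \<Longrightarrow> f = g"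
  unfolding GLat_hom by (rule arrow_eqI[of f g "carrier G" "carrier H"]) auto

lemma Matr_cmp_apply: "f \<in> hom_set Matr M N \<Longrightarrow> x \<in> ground M \<Longrightarrow> fn (g \<odot>\<^bsub>Matr\<^esub> f) x = fn g (fn f x)"
  by (simp add: Matr_hom) (simp add: Matr_def concrete_category_simps compose_def)

lemma GLat_cmp_apply: "f \<in> hom_set GLat G H \<Longrightarrow> x \<in> carrier G \<Longrightarrow> fn (g \<odot>\<^bsub>GLat\<^esub> f) x = fn g (fn f x)"
  by (simp add: GLat_hom) (simp add: GLat_def concrete_category_simps compose_def)

lemma Matr_ide_apply: "x \<in> ground M \<Longrightarrow> fn (Ide Matr M) x = x"
  by (simp add: Matr_def concrete_category_simps)

lemma GLat_ide_apply: "x \<in> carrier G \<Longrightarrow> fn (Ide GLat G) x = x"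
  by (simp add: GLat_def concrete_category_simps)

lemmas Matr_cmp_hom = category.cmp_hom[OF category_Matr]
  and GLat_cmp_hom = category.cmp_hom[OF category_GLat]

lemma Matr_ide_hom: "is_pointed_matroid M \<Longrightarrow> Ide Matr M \<in> hom_set Matr M M"
  by (rule category.ide_hom[OF category_Matr]) (simp add: Obj_Matr)

lemma GLat_ide_hom: "geometric_lattice G \<Longrightarrow> Ide GLat G \<in> hom_set GLat G G"
  by (rule category.ide_hom[OF category_GLat]) (simp add: Obj_GLat)

lemma Matr_homD:
  assumes "f \<in> hom_set Matr M N"
  shows "is_matroid M" "is_matroid N" "strong_map M N (fn f)" "x \<in> ground M \<Longrightarrow> fn f x \<in> ground N"
    "fn f (point M) = point N" "X \<subseteq> ground M \<Longrightarrow> fn f ` X \<subseteq> ground N"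
  using assms unfolding Matr_hom is_pointed_matroid_def strong_map_def by blast+

lemma GLat_homD:
  assumes "f \<in> hom_set GLat G H"
  shows "geometric_lattice G" "geometric_lattice H" "glat_morphism G H (fn f)"
    "x \<in> carrier G \<Longrightarrow> fn f x \<in> carrier H"
  using assms unfolding GLat_hom by blast+

lemma L_mor_apply:
  assumes f: "f \<in> hom_set Matr M N" and F: "F \<in> carrier (L_obj M)"
  shows "fset (fn (L_mor f) F) = cl N (fn f ` fset F)"
proof -
  have "fn f ` fset F \<subseteq> ground N"
    by (rule Matr_homD(6)[OF f carrier_L_ground[OF Matr_homD(1)[OF f] F]])
  then show ?thesis
    using f F by (simp add: L_mor_def Matr_hom fset_cl[OF Matr_homD(2)[OF f]])
qed

text \<open>Since a strong map satisfies \<open>f (cl X) \<subseteq> cl (f X)\<close>, closure can be deferred to the very end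
  when joins or composites are computed.\<close>

lemma L_mor_morphism:
  assumes f: "f \<in> hom_set Matr M N"
  shows "glat_morphism (L_obj M) (L_obj N) (fn (L_mor f))"
proof -
  note M = Matr_homD(1)[OF f] and N = Matr_homD(2)[OF f] and s = Matr_homD(3)[OF f]
    and sub = Matr_homD(6)[OF f]
  have gM: "fset F \<subseteq> ground M" if "F \<in> carrier (L_obj M)" for F by (rule carrier_L_ground[OF M that])
  have closed: "fn (L_mor f) F \<in> carrier (L_obj N)" if "F \<in> carrier (L_obj M)" for F
    using that by (simp add: carrier_L[OF N] L_mor_apply[OF f that] cl_flat[OF N sub[OF gM[OF that]]])
  show ?thesis
    unfolding glat_morphism_def
  proof (intro conjI allI impI ballI)
    show "fn (L_mor f) ` carrier (L_obj M) \<subseteq> carrier (L_obj N)" using closed by blast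
  next
    fix \<A> assume \<A>: "\<A> \<subseteq> carrier (L_obj M)"
    have U: "\<Union>(fset ` \<A>) \<subseteq> ground M" using \<A> gM by blast
    have im: "fn (L_mor f) ` \<A> \<subseteq> carrier (L_obj N)" using \<A> closed by blast
    have fs: "fset (fn (L_mor f) F) = cl N (fn f ` fset F)" if "F \<in> \<A>" for F
      using that \<A> by (intro L_mor_apply[OF f]) blast
    have sc: "\<Squnion>\<^bsub>L_obj M\<^esub> \<A> \<in> carrier (L_obj M)" by (rule glat_sup_closed[OF L_geometric[OF M] \<A>])
    have "fset (fn (L_mor f) (\<Squnion>\<^bsub>L_obj M\<^esub> \<A>)) = cl N (fn f ` \<Union>(fset ` \<A>))"
      by (simp add: L_mor_apply[OF f sc] L_sup[OF M \<A>] cl_image_cl[OF M N s U])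
    also have "\<dots> = cl N (\<Union>(fset ` fn (L_mor f) ` \<A>))"
    proof (rule cl_eqI[OF N])
      show "fn f ` \<Union>(fset ` \<A>) \<subseteq> ground N" by (rule sub[OF U])
      show "\<Union>(fset ` fn (L_mor f) ` \<A>) \<subseteq> ground N" using im carrier_L_ground[OF N] by blast
      fix K assume K: "K \<in> flats N"
      have "\<Union>(fset ` fn (L_mor f) ` \<A>) \<subseteq> K \<longleftrightarrow> (\<forall>F \<in> \<A>. fset (fn (L_mor f) F) \<subseteq> K)" by blast
      also have "\<dots> \<longleftrightarrow> (\<forall>F \<in> \<A>. fn f ` fset F \<subseteq> K)"
        by (rule ball_cong[OF refl]) (simp only: fs cl_subset_iff[OF N K])
      finally show "fn f ` \<Union>(fset ` \<A>) \<subseteq> K \<longleftrightarrow> \<Union>(fset ` fn (L_mor f) ` \<A>) \<subseteq> K" by blast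
    qed
    also have "\<dots> = fset (\<Squnion>\<^bsub>L_obj N\<^esub> (fn (L_mor f) ` \<A>))" by (simp only: L_sup[OF N im])
    finally show "fn (L_mor f) (\<Squnion>\<^bsub>L_obj M\<^esub> \<A>) = \<Squnion>\<^bsub>L_obj N\<^esub> (fn (L_mor f) ` \<A>)"
      by (simp only: fset_inject)
  next
    fix F assume F: "F \<in> atoms (L_obj M)"
    then have Fc: "F \<in> carrier (L_obj M)" using atoms_carrier[OF L_geometric[OF M]] by blast
    from F obtain x where x: "nonloop M x" "fset F = cl M {x}" by (auto simp: L_atoms[OF M])
    then have xg: "{x} \<subseteq> ground M" by (simp add: nonloop_def)
    have e: "fset (fn (L_mor f) F) = cl N {fn f x}"
      using cl_image_cl[OF M N s xg] by (simp add: L_mor_apply[OF f Fc] x)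
    show "fn (L_mor f) F \<in> atoms (L_obj N) \<or> fn (L_mor f) F = \<bottom>\<^bsub>L_obj N\<^esub>"
    proof (cases "loop N (fn f x)")
      case True
      then have "fset (fn (L_mor f) F) = fset \<bottom>\<^bsub>L_obj N\<^esub>"
        by (simp add: e cl_loop[OF N] L_bottom[OF N])
      then show ?thesis unfolding fset_inject by (rule disjI2)
    next
      case False
      then have "nonloop N (fn f x)" using Matr_homD(4)[OF f, of x] xg by (simp add: nonloop_def)
      then have "\<exists>y. nonloop N y \<and> fset (fn (L_mor f) F) = cl N {y}" using e by blast
      then show ?thesis unfolding L_atoms[OF N] by (rule disjI1)
    qed
  qed
qed

lemma L_mor_hom:
  assumes f: "f \<in> hom_set Matr M N"
  shows "L_mor f \<in> hom_set GLat (L_obj M) (L_obj N)"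
proof -
  have "fn (L_mor f) \<in> carrier (L_obj M) \<rightarrow>\<^sub>E carrier (L_obj N)"
  proof
    show "fn (L_mor f) F \<in> carrier (L_obj N)" if "F \<in> carrier (L_obj M)" for F
      using that by (rule glat_morphismD(1)[OF L_mor_morphism[OF f]])
    show "fn (L_mor f) F = undefined" if "F \<notin> carrier (L_obj M)" for F
      using that f by (simp add: L_mor_def Matr_hom)
  qed
  moreover have "source (L_mor f) = L_obj M" "target (L_mor f) = L_obj N"
    using f by (simp_all add: L_mor_def Matr_hom)
  ultimately show ?thesis
    using L_geometric[OF Matr_homD(1)[OF f]] L_geometric[OF Matr_homD(2)[OF f]] L_mor_morphism[OF f]
    by (simp add: GLat_hom)
qed

lemma L_functor_simps: "on_obj L_functor = L_obj" "on_mor L_functor = L_mor"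
  by (simp_all add: L_functor_def)

lemma S_functor_simps: "on_obj S_functor = S_obj" "on_mor S_functor = S_mor"
  by (simp_all add: S_functor_def)

lemma is_functor_L: "is_functor Matr GLat L_functor"
proof (intro is_functor.intro is_functor_axioms.intro category_Matr category_GLat,
    unfold L_functor_simps Obj_Matr Obj_GLat mem_Collect_eq)
  fix M :: "'a matr" assume M: "is_pointed_matroid M"
  then have m: "is_matroid M" by (simp add: is_pointed_matroid_def)
  show g: "geometric_lattice (L_obj M)" by (rule L_geometric[OF m])
  show "L_mor (Ide Matr M) = Ide GLat (L_obj M)"
  proof (rule GLat_eqI[OF L_mor_hom[OF Matr_ide_hom[OF M]] GLat_ide_hom[OF g]])
    fix F assume F: "F \<in> carrier (L_obj M)"
    have "fn (Ide Matr M) ` fset F = fset F"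
      using carrier_L_ground[OF m F] by (force simp: Matr_ide_apply)
    then have "fset (fn (L_mor (Ide Matr M)) F) = fset F"
      using F by (simp add: L_mor_apply[OF Matr_ide_hom[OF M] F] cl_of_flat[OF m] carrier_L[OF m])
    then show "fn (L_mor (Ide Matr M)) F = fn (Ide GLat (L_obj M)) F"
      by (simp add: fset_inject GLat_ide_apply[OF F])
  qed
next
  fix f and M N :: "'a matr" assume "f \<in> hom_set Matr M N"
  then show "L_mor f \<in> hom_set GLat (L_obj M) (L_obj N)" by (rule L_mor_hom)
next
  fix f g and M N K :: "'a matr"
  assume f: "f \<in> hom_set Matr M N" and g: "g \<in> hom_set Matr N K"
  note fg = Matr_cmp_hom[OF f g]
  note Lf = L_mor_hom[OF f]
  show "L_mor (g \<odot>\<^bsub>Matr\<^esub> f) = L_mor g \<odot>\<^bsub>GLat\<^esub> L_mor f"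
  proof (rule GLat_eqI[OF L_mor_hom[OF fg] GLat_cmp_hom[OF Lf L_mor_hom[OF g]]])
    fix F assume F: "F \<in> carrier (L_obj M)"
    have sub: "fset F \<subseteq> ground M" by (rule carrier_L_ground[OF Matr_homD(1)[OF f] F])
    have "fn (g \<odot>\<^bsub>Matr\<^esub> f) ` fset F = fn g ` fn f ` fset F"
      unfolding image_image using sub by (intro image_cong) (auto simp: Matr_cmp_apply[OF f])
    then have "fset (fn (L_mor (g \<odot>\<^bsub>Matr\<^esub> f)) F) = cl K (fn g ` cl N (fn f ` fset F))"
      using cl_image_cl[OF Matr_homD(1-3)[OF g] Matr_homD(6)[OF f sub]]
      by (simp add: L_mor_apply[OF fg F])
    also have "\<dots> = fset (fn (L_mor g) (fn (L_mor f) F))"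
      using L_mor_apply[OF g GLat_homD(4)[OF Lf F]] by (simp add: L_mor_apply[OF f F])
    finally show "fn (L_mor (g \<odot>\<^bsub>Matr\<^esub> f)) F = fn (L_mor g \<odot>\<^bsub>GLat\<^esub> L_mor f) F"
      by (simp add: fset_inject GLat_cmp_apply[OF Lf F])
  qed
qed

lemma S_mor_Bullet: "g \<in> hom_set GLat G H \<Longrightarrow> fn (S_mor g) Bullet = Bullet"
  by (simp add: S_mor_def GLat_hom ground_S)

lemma S_mor_Elem:
  "g \<in> hom_set GLat G H \<Longrightarrow> a \<in> atoms G \<Longrightarrow>
     fn (S_mor g) (Elem a) = (if fn g a = \<bottom>\<^bsub>H\<^esub> then Bullet else Elem (fn g a))"
  by (simp add: S_mor_def GLat_hom ground_S)

lemma GLat_hom_sup_atoms: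
  assumes g: "g \<in> hom_set GLat G H" and A: "A \<subseteq> carrier G" and y: "y \<in> carrier H"
  shows "fn g (\<Squnion>\<^bsub>G\<^esub> A) \<sqsubseteq>\<^bsub>H\<^esub> y \<longleftrightarrow> (\<forall>a \<in> A. fn g a \<sqsubseteq>\<^bsub>H\<^esub> y)"
proof -
  have "fn g ` A \<subseteq> carrier H" using A GLat_homD(4)[OF g] by blast
  from glat_sup_le_iff[OF GLat_homD(2)[OF g] this y] show ?thesis
    by (simp add: glat_morphismD(3)[OF GLat_homD(3)[OF g] A])
qed

lemma GLat_hom_le_iff_atoms:
  assumes g: "g \<in> hom_set GLat G H" and x: "x \<in> carrier G" and y: "y \<in> carrier H"
  shows "fn g x \<sqsubseteq>\<^bsub>H\<^esub> y \<longleftrightarrow> (\<forall>a \<in> atoms G. a \<sqsubseteq>\<^bsub>G\<^esub> x \<longrightarrow> fn g a \<sqsubseteq>\<^bsub>H\<^esub> y)"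
proof -
  note G = GLat_homD(1)[OF g]
  have "{a \<in> atoms G. a \<sqsubseteq>\<^bsub>G\<^esub> x} \<subseteq> carrier G" using atoms_carrier[OF G] by blast
  from GLat_hom_sup_atoms[OF g this y] show ?thesis unfolding atomistic[OF G x] by blast
qed

lemma S_mor_mem_atom_flat:
  assumes g: "g \<in> hom_set GLat G H" and a: "a \<in> atoms G" and y: "y \<in> carrier H"
  shows "fn (S_mor g) (Elem a) \<in> atom_flat H y \<longleftrightarrow> fn g a \<sqsubseteq>\<^bsub>H\<^esub> y"
proof (cases "fn g a = \<bottom>\<^bsub>H\<^esub>")
  case True
  then show ?thesis
    using glat_bot(2)[OF GLat_homD(2)[OF g] y] by (simp add: S_mor_Elem[OF g a] Bullet_atom_flat)
next
  case False
  then have "fn g a \<in> atoms H" using glat_morphismD(4)[OF GLat_homD(3)[OF g] a] by blast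
  with False show ?thesis by (simp add: S_mor_Elem[OF g a] Elem_atom_flat)
qed

text \<open>A join-preserving map has an upper adjoint, and preimages of flats are given by that adjoint:
  \<open>fn g a \<sqsubseteq> y\<close> holds iff \<open>a\<close> lies below the join of all atoms with this property.\<close>

lemma S_mor_strong:
  assumes g: "g \<in> hom_set GLat G H"
  shows "strong_map (S_obj G) (S_obj H) (fn (S_mor g))"
proof -
  note G = GLat_homD(1)[OF g] and H = GLat_homD(2)[OF g]
  have "fn (S_mor g) e \<in> ground (S_obj H)" if "e \<in> ground (S_obj G)" for e
  proof -
    have "fn (S_mor g) (Elem a) \<in> ground (S_obj H)" if "a \<in> atoms G" for a
      using glat_morphismD(4)[OF GLat_homD(3)[OF g] that] by (auto simp: S_mor_Elem[OF g that] ground_S)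
    then show ?thesis using that by (auto simp: ground_S S_mor_Bullet[OF g])
  qed
  moreover have "{e \<in> ground (S_obj G). fn (S_mor g) e \<in> F} \<in> flats (S_obj G)"
    if F: "F \<in> flats (S_obj H)" for F
  proof -
    from F obtain y where y: "y \<in> carrier H" "F = atom_flat H y" by (auto simp: flats_S)
    define A where "A = {a \<in> atoms G. fn g a \<sqsubseteq>\<^bsub>H\<^esub> y}"
    have A: "A \<subseteq> carrier G" using atoms_carrier[OF G] by (auto simp: A_def)
    have x: "\<Squnion>\<^bsub>G\<^esub> A \<in> carrier G" by (rule glat_sup_closed[OF G A])
    have "fn g (\<Squnion>\<^bsub>G\<^esub> A) \<sqsubseteq>\<^bsub>H\<^esub> y" 
      unfolding GLat_hom_sup_atoms[OF g A y(1)] by (simp add: A_def)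
    then have *: "a \<sqsubseteq>\<^bsub>G\<^esub> \<Squnion>\<^bsub>G\<^esub> A \<longleftrightarrow> fn g a \<sqsubseteq>\<^bsub>H\<^esub> y" if "a \<in> atoms G" for a
      using that GLat_hom_le_iff_atoms[OF g x y(1)] glat_sup_le_iff[OF G A x] glat_refl[OF G x]
      by (auto simp: A_def)
    have "{e \<in> ground (S_obj G). fn (S_mor g) e \<in> F} = atom_flat G (\<Squnion>\<^bsub>G\<^esub> A)"
      by (auto simp: ground_S y(2) S_mor_Bullet[OF g] Bullet_atom_flat Elem_atom_flat *
          S_mor_mem_atom_flat[OF g _ y(1)] simp: atom_flat_def[of G])
    then show ?thesis using x by (simp add: flats_S)
  qed
  ultimately show ?thesis by (auto simp: strong_map_def)
qed

lemma S_mor_hom: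
  assumes g: "g \<in> hom_set GLat G H"
  shows "S_mor g \<in> hom_set Matr (S_obj G) (S_obj H)"
proof -
  have "fn (S_mor g) \<in> ground (S_obj G) \<rightarrow>\<^sub>E ground (S_obj H)"
  proof
    show "fn (S_mor g) e \<in> ground (S_obj H)" if "e \<in> ground (S_obj G)" for e
      using S_mor_strong[OF g] that by (auto simp: strong_map_def)
    show "fn (S_mor g) e = undefined" if "e \<notin> ground (S_obj G)" for e
      using that g by (simp add: S_mor_def GLat_hom)
  qed
  moreover have "source (S_mor g) = S_obj G" "target (S_mor g) = S_obj H"
    using g by (simp_all add: S_mor_def GLat_hom)
  ultimately show ?thesis
    using S_is_pointed[OF GLat_homD(1)[OF g]] S_is_pointed[OF GLat_homD(2)[OF g]] S_mor_strong[OF g]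
    by (simp add: Matr_hom point_S S_mor_Bullet[OF g])
qed

lemma is_functor_S: "is_functor GLat Matr S_functor"
proof (intro is_functor.intro is_functor_axioms.intro category_Matr category_GLat,
    unfold S_functor_simps Obj_Matr Obj_GLat mem_Collect_eq)
  fix G :: "'a glat" assume G: "geometric_lattice G"
  show p: "is_pointed_matroid (S_obj G)" by (rule S_is_pointed[OF G])
  note id = GLat_ide_hom[OF G]
  show "S_mor (Ide GLat G) = Ide Matr (S_obj G)"
  proof (rule Matr_eqI[OF S_mor_hom[OF id] Matr_ide_hom[OF p]])
    fix e assume e: "e \<in> ground (S_obj G)"
    have "fn (S_mor (Ide GLat G)) (Elem a) = Elem a" if "a \<in> atoms G" for a
      using that by (simp add: S_mor_Elem[OF id that] GLat_ide_apply atom_iff[OF G])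
    then have "fn (S_mor (Ide GLat G)) e = e"
      using e by (auto simp: ground_S S_mor_Bullet[OF id])
    then show "fn (S_mor (Ide GLat G)) e = fn (Ide Matr (S_obj G)) e"
      by (simp add: Matr_ide_apply[OF e])
  qed
next
  fix f and G H :: "'a glat" assume "f \<in> hom_set GLat G H"
  then show "S_mor f \<in> hom_set Matr (S_obj G) (S_obj H)" by (rule S_mor_hom)
next
  fix f g and G H K :: "'a glat"
  assume f: "f \<in> hom_set GLat G H" and g: "g \<in> hom_set GLat H K"
  note fg = GLat_cmp_hom[OF f g]
  note Sf = S_mor_hom[OF f] 
  show "S_mor (g \<odot>\<^bsub>GLat\<^esub> f) = S_mor g \<odot>\<^bsub>Matr\<^esub> S_mor f"
  proof (rule Matr_eqI[OF S_mor_hom[OF fg] Matr_cmp_hom[OF Sf S_mor_hom[OF g]]])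
    fix e assume e: "e \<in> ground (S_obj G)"
    have "fn (S_mor (g \<odot>\<^bsub>GLat\<^esub> f)) (Elem a) = fn (S_mor g) (fn (S_mor f) (Elem a))"
      if a: "a \<in> atoms G" for a
    proof -
      have ac: "a \<in> carrier G" using a by (simp add: atom_iff[OF GLat_homD(1)[OF f]])
      have b: "fn g \<bottom>\<^bsub>H\<^esub> = \<bottom>\<^bsub>K\<^esub>" by (rule glat_morphism_bottom[OF GLat_homD(1-3)[OF g]])
      have "fn f a \<in> atoms H" if "fn f a \<noteq> \<bottom>\<^bsub>H\<^esub>"
        using that glat_morphismD(4)[OF GLat_homD(3)[OF f] a] by blast
      then show ?thesis
        by (simp add: S_mor_Elem[OF fg a] S_mor_Elem[OF f a] GLat_cmp_apply[OF f ac]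
            S_mor_Bullet[OF g] S_mor_Elem[OF g] b)
    qed
    then have "fn (S_mor (g \<odot>\<^bsub>GLat\<^esub> f)) e = fn (S_mor g) (fn (S_mor f) e)"
      using e by (auto simp: ground_S S_mor_Bullet[OF f] S_mor_Bullet[OF g] S_mor_Bullet[OF fg])
    then show "fn (S_mor (g \<odot>\<^bsub>GLat\<^esub> f)) e = fn (S_mor g \<odot>\<^bsub>Matr\<^esub> S_mor f) e"
      by (simp add: Matr_cmp_apply[OF Sf e])
  qed
qed

section \<open>Unit and counit\<close>

lemma matroid_of_pointed: "is_pointed_matroid M \<Longrightarrow> is_matroid M"
  and point_loop: "is_pointed_matroid M \<Longrightarrow> loop M (point M)"
  by (simp_all add: is_pointed_matroid_def)

context
  fixes M :: "'a matr"
  assumes pM: "is_pointed_matroid M"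
begin

lemmas matroid = matroid_of_pointed[OF pM]

lemma si_unit_loop: "loop M x \<Longrightarrow> fn (si_unit M) x = Bullet"
  by (simp add: si_unit_def loop_def)

lemma si_unit_nonloop: "nonloop M x \<Longrightarrow> fn (si_unit M) x = Elem (Abs_fset (cl M {x}))"
  by (simp add: si_unit_def nonloop_def)

lemma fset_cl_point: "x \<in> ground M \<Longrightarrow> fset (Abs_fset (cl M {x})) = cl M {x}"
  by (rule fset_cl[OF matroid]) simp

lemma nonloop_atom: "nonloop M x \<Longrightarrow> Abs_fset (cl M {x}) \<in> atoms (L_obj M)"
  using fset_cl_point by (auto simp: L_atoms[OF matroid] nonloop_def)

text \<open>The atom \<open>cl {x}\<close> of a nonloop is below \<open>F\<close> iff \<open>x \<in> F\<close>; a loop goes to the point, and both lie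
  in all flats. So the unit pulls the flats of its target back to the flats of \<open>M\<close>.\<close>

lemma si_unit_mem_atom_flat:
  assumes x: "x \<in> ground M" and F: "F \<in> carrier (L_obj M)"
  shows "fn (si_unit M) x \<in> atom_flat (L_obj M) F \<longleftrightarrow> x \<in> fset F"
proof (cases "loop M x")
  case True
  then show ?thesis using F by (simp add: si_unit_loop Bullet_atom_flat loop_def carrier_L[OF matroid])
next
  case False
  then have n: "nonloop M x" using x by (simp add: nonloop_def)
  have "Abs_fset (cl M {x}) \<sqsubseteq>\<^bsub>L_obj M\<^esub> F \<longleftrightarrow> x \<in> fset F"
    using F by (simp add: le_L[OF matroid] fset_cl_point[OF x] cl_subset_iff[OF matroid]
        carrier_L[OF matroid])
  then show ?thesis by (simp add: si_unit_nonloop[OF n] Elem_atom_flat nonloop_atom[OF n])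
qed

lemma si_unit_ground: "x \<in> ground M \<Longrightarrow> fn (si_unit M) x \<in> ground (S_obj (L_obj M))"
  using si_unit_loop si_unit_nonloop nonloop_atom by (cases "loop M x") (auto simp: ground_S nonloop_def)

lemma si_unit_hom: "si_unit M \<in> hom_set Matr M (S_obj (L_obj M))"
proof -
  have "strong_map M (S_obj (L_obj M)) (fn (si_unit M))"
    unfolding strong_map_def
  proof (intro conjI ballI)
    show "fn (si_unit M) ` ground M \<subseteq> ground (S_obj (L_obj M))" using si_unit_ground by blast
    fix K assume "K \<in> flats (S_obj (L_obj M))"
    then obtain F where F: "F \<in> carrier (L_obj M)" "K = atom_flat (L_obj M) F"
      by (auto simp: flats_S)
    have "{x \<in> ground M. fn (si_unit M) x \<in> K} = fset F"
      using carrier_L_ground[OF matroid F(1)] by (auto simp: F(2) si_unit_mem_atom_flat[OF _ F(1)])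
    then show "{x \<in> ground M. fn (si_unit M) x \<in> K} \<in> flats M"
      using F(1) by (simp add: carrier_L[OF matroid])
  qed
  moreover have "fn (si_unit M) \<in> ground M \<rightarrow>\<^sub>E ground (S_obj (L_obj M))"
  proof
    show "fn (si_unit M) x \<in> ground (S_obj (L_obj M))" if "x \<in> ground M" for x
      by (rule si_unit_ground[OF that])
    show "fn (si_unit M) x = undefined" if "x \<notin> ground M" for x
      using that by (simp add: si_unit_def)
  qed
  moreover have "source (si_unit M) = M" "target (si_unit M) = S_obj (L_obj M)"
    by (simp_all add: si_unit_def)
  ultimately show ?thesis
    using pM S_is_pointed[OF L_geometric[OF matroid]] si_unit_loop[OF point_loop[OF pM]]
    by (simp add: Matr_hom point_S)
qed

end

text \<open>On a nonloop \<open>x\<close> both sides are determined by the closure of \<open>f x\<close> in \<open>N\<close>, as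
  \<open>cl (f (cl {x})) = cl {f x}\<close>; the case distinctions in the two functions agree because that closure
  is the least flat exactly when \<open>f x\<close> is a loop.\<close>

lemma si_unit_natural:
  assumes f: "f \<in> hom_set Matr M N"
  shows "si_unit N \<odot>\<^bsub>Matr\<^esub> f = S_mor (L_mor f) \<odot>\<^bsub>Matr\<^esub> si_unit M"
proof -
  have pM: "is_pointed_matroid M" and pN: "is_pointed_matroid N" using f by (simp_all add: Matr_hom)
  note uM = si_unit_hom[OF pM] and uN = si_unit_hom[OF pN] and Lf = L_mor_hom[OF f]
  note M = Matr_homD(1)[OF f] and N = Matr_homD(2)[OF f]
  have "fn (si_unit N) (fn f x) = fn (S_mor (L_mor f)) (fn (si_unit M) x)" if x: "x \<in> ground M" for x
  proof (cases "loop M x")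
    case True
    then have "loop N (fn f x)" by (rule strong_map_loop[OF Matr_homD(3)[OF f]])
    with True show ?thesis by (simp add: si_unit_loop[OF pM] si_unit_loop[OF pN] S_mor_Bullet[OF Lf])
  next
    case False
    then have n: "nonloop M x" using x by (simp add: nonloop_def)
    define F where "F = Abs_fset (cl M {x})"
    have Fa: "F \<in> atoms (L_obj M)" unfolding F_def by (rule nonloop_atom[OF pM n])
    then have Fc: "F \<in> carrier (L_obj M)" using atoms_carrier[OF L_geometric[OF M]] by blast
    have "cl N (fn f ` cl M {x}) = cl N {fn f x}"
      using cl_image_cl[OF M N Matr_homD(3)[OF f], of "{x}"] x by simp
    then have LF: "fset (fn (L_mor f) F) = cl N {fn f x}"
      by (simp add: L_mor_apply[OF f Fc]) (simp add: F_def fset_cl_point[OF pM x])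
    have bot: "fn (L_mor f) F = \<bottom>\<^bsub>L_obj N\<^esub> \<longleftrightarrow> loop N (fn f x)"
    proof
      assume "fn (L_mor f) F = \<bottom>\<^bsub>L_obj N\<^esub>"
      then have "cl N {fn f x} = cl N {}" using LF L_bottom[OF N] by simp
      then show "loop N (fn f x)" using cl_superset[OF N, of "{fn f x}"] by (simp add: loop_iff[OF N])
    next
      assume "loop N (fn f x)"
      then have "fset (fn (L_mor f) F) = fset \<bottom>\<^bsub>L_obj N\<^esub>"
        by (simp add: LF cl_loop[OF N] L_bottom[OF N])
      then show "fn (L_mor f) F = \<bottom>\<^bsub>L_obj N\<^esub>" unfolding fset_inject .
    qed
    have eq: "Abs_fset (cl N {fn f x}) = fn (L_mor f) F" by (simp add: LF[symmetric] fset_inverse)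
    have Sx: "fn (S_mor (L_mor f)) (fn (si_unit M) x)
        = (if loop N (fn f x) then Bullet else Elem (fn (L_mor f) F))"
      unfolding si_unit_nonloop[OF pM n] F_def[symmetric] S_mor_Elem[OF Lf Fa] bot ..
    show ?thesis
    proof (cases "loop N (fn f x)")
      case True
      then show ?thesis by (simp add: Sx si_unit_loop[OF pN])
    next
      case False
      then have "nonloop N (fn f x)" using Matr_homD(4)[OF f x] by (simp add: nonloop_def)
      then show ?thesis using False by (simp add: Sx si_unit_nonloop[OF pN] eq)
    qed
  qed
  then show ?thesis
    by (intro Matr_eqI[OF Matr_cmp_hom[OF f uN] Matr_cmp_hom[OF uM S_mor_hom[OF Lf]]])
      (simp add: Matr_cmp_apply[OF f] Matr_cmp_apply[OF uM])
qed

context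
  fixes G :: "'a glat"
  assumes G: "geometric_lattice G"
begin

text \<open>Since \<open>G\<close> is atomistic, \<open>x\<close> can be recovered from the flat of atoms below it; so the counit is
  inverse to \<^const>\<open>atom_flat\<close>, and it is computed below only through this property.\<close>

lemma counit_apply:
  assumes x: "x \<in> carrier G" and F: "fset F = atom_flat G x"
  shows "fn (counit G) F = x"
proof -
  have "F \<in> carrier (L_obj (S_obj G))" using x F carrier_LS[OF G] by blast
  moreover have "{a \<in> atoms G. Elem a |\<in>| F} = {a \<in> atoms G. a \<sqsubseteq>\<^bsub>G\<^esub> x}"
    by (simp add: F Elem_atom_flat cong: conj_cong)
  ultimately show ?thesis by (simp add: counit_def atomistic[OF G x])
qed

lemma counit_inverse:
  assumes "F \<in> carrier (L_obj (S_obj G))"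
  shows "fn (counit G) F \<in> carrier G" "fset F = atom_flat G (fn (counit G) F)"
  using assms counit_apply unfolding carrier_LS[OF G] by auto

lemma counit_hom: "counit G \<in> hom_set GLat (L_obj (S_obj G)) G"
proof -
  have S: "is_matroid (S_obj G)" by (rule S_is_matroid[OF G])
  have "glat_morphism (L_obj (S_obj G)) G (fn (counit G))"
    unfolding glat_morphism_def
  proof (intro conjI allI impI ballI)
    show "fn (counit G) ` carrier (L_obj (S_obj G)) \<subseteq> carrier G" using counit_inverse by blast
  next
    fix \<F> assume \<F>: "\<F> \<subseteq> carrier (L_obj (S_obj G))"
    have im: "fn (counit G) ` \<F> \<subseteq> carrier G" using counit_inverse(1) \<F> by blast
    have s: "\<Squnion>\<^bsub>G\<^esub> (fn (counit G) ` \<F>) \<in> carrier G" by (rule glat_sup_closed[OF G im])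
    have "fset (\<Squnion>\<^bsub>L_obj (S_obj G)\<^esub> \<F>) = atom_flat G (\<Squnion>\<^bsub>G\<^esub> (fn (counit G) ` \<F>))"
      unfolding L_sup[OF S \<F>]
    proof (rule cl_S_eqI[OF G s])
      fix z assume z: "z \<in> carrier G"
      have "fset F \<subseteq> atom_flat G z \<longleftrightarrow> fn (counit G) F \<sqsubseteq>\<^bsub>G\<^esub> z" if "F \<in> \<F>" for F
      proof -
        have F: "F \<in> carrier (L_obj (S_obj G))" using that \<F> by blast
        show ?thesis
          by (subst counit_inverse(2)[OF F]) (rule atom_flat_subset[OF G counit_inverse(1)[OF F] z])
      qed
      then have "\<Union>(fset ` \<F>) \<subseteq> atom_flat G z \<longleftrightarrow> (\<forall>F \<in> \<F>. fn (counit G) F \<sqsubseteq>\<^bsub>G\<^esub> z)"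
        unfolding UN_subset_iff by (rule ball_cong[OF refl])
      then show "\<Union>(fset ` \<F>) \<subseteq> atom_flat G z \<longleftrightarrow> \<Squnion>\<^bsub>G\<^esub> (fn (counit G) ` \<F>) \<sqsubseteq>\<^bsub>G\<^esub> z"
        by (simp add: glat_sup_le_iff[OF G im z])
    qed
    then show "fn (counit G) (\<Squnion>\<^bsub>L_obj (S_obj G)\<^esub> \<F>) = \<Squnion>\<^bsub>G\<^esub> (fn (counit G) ` \<F>)"
      by (rule counit_apply[OF s])
  next
    fix F assume "F \<in> atoms (L_obj (S_obj G))"
    then obtain a where a: "a \<in> atoms G" "fset F = atom_flat G a" unfolding atoms_LS[OF G] by blast
    then have "fn (counit G) F = a" using atoms_carrier[OF G] by (intro counit_apply) auto
    then show "fn (counit G) F \<in> atoms G \<or> fn (counit G) F = \<bottom>\<^bsub>G\<^esub>" using a by simp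
  qed
  moreover have "fn (counit G) \<in> carrier (L_obj (S_obj G)) \<rightarrow>\<^sub>E carrier G"
  proof
    show "fn (counit G) F \<in> carrier G" if "F \<in> carrier (L_obj (S_obj G))" for F
      by (rule counit_inverse(1)[OF that])
    show "fn (counit G) F = undefined" if "F \<notin> carrier (L_obj (S_obj G))" for F
      using that by (simp add: counit_def)
  qed
  moreover have "source (counit G) = L_obj (S_obj G)" "target (counit G) = G"
    by (simp_all add: counit_def)
  ultimately show ?thesis using G L_geometric[OF S] by (simp add: GLat_hom)
qed

lemma triangle_S: "S_mor (counit G) \<odot>\<^bsub>Matr\<^esub> si_unit (S_obj G) = Ide Matr (S_obj G)"
proof -
  have p: "is_pointed_matroid (S_obj G)" by (rule S_is_pointed[OF G])
  note u = si_unit_hom[OF p] and c = S_mor_hom[OF counit_hom]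
  have atom: "fn (S_mor (counit G)) (fn (si_unit (S_obj G)) (Elem a)) = Elem a" if a: "a \<in> atoms G" for a
  proof -
    have n: "nonloop (S_obj G) (Elem a)" using a by (simp add: nonloop_def loop_S[OF G] ground_S)
    then have g: "Elem a \<in> ground (S_obj G)" by (simp add: nonloop_def)
    have at: "Abs_fset (cl (S_obj G) {Elem a}) \<in> atoms (L_obj (S_obj G))" by (rule nonloop_atom[OF p n])
    have "fn (counit G) (Abs_fset (cl (S_obj G) {Elem a})) = a"
      using a fset_cl_point[OF p g] cl_S_atom[OF G a] by (intro counit_apply) (auto simp: atom_iff[OF G])
    then show ?thesis
      using a by (simp add: si_unit_nonloop[OF p n] S_mor_Elem[OF counit_hom at] atom_iff[OF G])
  qed
  have Bullet: "fn (S_mor (counit G)) (fn (si_unit (S_obj G)) Bullet) = Bullet"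
    by (simp add: si_unit_loop[OF p] loop_S[OF G] S_mor_Bullet[OF counit_hom])
  show ?thesis
  proof (rule Matr_eqI[OF Matr_cmp_hom[OF u c] Matr_ide_hom[OF p]])
    fix e assume e: "e \<in> ground (S_obj G)"
    then have "fn (S_mor (counit G)) (fn (si_unit (S_obj G)) e) = e"
      using atom Bullet by (auto simp: ground_S)
    then show "fn (S_mor (counit G) \<odot>\<^bsub>Matr\<^esub> si_unit (S_obj G)) e = fn (Ide Matr (S_obj G)) e"
      by (simp add: Matr_cmp_apply[OF u e] Matr_ide_apply[OF e])
  qed
qed

end

lemma counit_natural:
  assumes g: "g \<in> hom_set GLat G H"
  shows "counit H \<odot>\<^bsub>GLat\<^esub> L_mor (S_mor g) = g \<odot>\<^bsub>GLat\<^esub> counit G"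
proof -
  note G = GLat_homD(1)[OF g] and H = GLat_homD(2)[OF g]
  note cG = counit_hom[OF G] and cH = counit_hom[OF H] and Sg = S_mor_hom[OF g]
  note LSg = L_mor_hom[OF Sg]
  have "fn (counit H) (fn (L_mor (S_mor g)) F) = fn g (fn (counit G) F)"
    if F: "F \<in> carrier (L_obj (S_obj G))" for F
  proof (rule counit_apply[OF H])
    define x where "x = fn (counit G) F"
    have x: "x \<in> carrier G" and Fx: "fset F = atom_flat G x"
      unfolding x_def using counit_inverse[OF G F] by auto
    show gx: "fn g x \<in> carrier H" by (rule GLat_homD(4)[OF g x])
    show "fset (fn (L_mor (S_mor g)) F) = atom_flat H (fn g x)"
      unfolding L_mor_apply[OF Sg F]
    proof (rule cl_S_eqI[OF H gx])
      fix z assume z: "z \<in> carrier H"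
      have "fn (S_mor g) ` fset F \<subseteq> atom_flat H z \<longleftrightarrow>
          (\<forall>a \<in> atoms G. a \<sqsubseteq>\<^bsub>G\<^esub> x \<longrightarrow> fn (S_mor g) (Elem a) \<in> atom_flat H z)"
        by (auto simp: Fx atom_flat_def[of G] S_mor_Bullet[OF g] Bullet_atom_flat)
      then show "fn (S_mor g) ` fset F \<subseteq> atom_flat H z \<longleftrightarrow> fn g x \<sqsubseteq>\<^bsub>H\<^esub> z"
        by (simp add: S_mor_mem_atom_flat[OF g _ z] GLat_hom_le_iff_atoms[OF g x z])
    qed
  qed
  then show ?thesis
    by (intro GLat_eqI[OF GLat_cmp_hom[OF LSg cH] GLat_cmp_hom[OF cG g]])
      (simp add: GLat_cmp_apply[OF LSg] GLat_cmp_apply[OF cG])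
qed

text \<open>The closure of the image of a flat \<open>F\<close> under the unit is the flat of atoms below \<open>F\<close>: it is
  contained in the flat of atoms below \<open>K\<close> iff \<open>F\<close> is contained in the preimage of the latter, which
  is \<open>K\<close>.\<close>

lemma triangle_L:
  assumes p: "is_pointed_matroid M"
  shows "counit (L_obj M) \<odot>\<^bsub>GLat\<^esub> L_mor (si_unit M) = Ide GLat (L_obj M)"
proof -
  note M = matroid_of_pointed[OF p] and u = si_unit_hom[OF p]
  note G = L_geometric[OF M]
  note Lu = L_mor_hom[OF u]
  show ?thesis
  proof (rule GLat_eqI[OF GLat_cmp_hom[OF Lu counit_hom[OF G]] GLat_ide_hom[OF G]])
    fix F assume F: "F \<in> carrier (L_obj M)"
    have sub: "fset F \<subseteq> ground M" by (rule carrier_L_ground[OF M F])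
    have "fset (fn (L_mor (si_unit M)) F) = atom_flat (L_obj M) F"
      unfolding L_mor_apply[OF u F]
    proof (rule cl_S_eqI[OF G F])
      fix K assume K: "K \<in> carrier (L_obj M)"
      have "fn (si_unit M) ` fset F \<subseteq> atom_flat (L_obj M) K \<longleftrightarrow> 
          (\<forall>x \<in> fset F. fn (si_unit M) x \<in> atom_flat (L_obj M) K)" by blast
      also have "\<dots> \<longleftrightarrow> (\<forall>x \<in> fset F. x \<in> fset K)"
        using sub by (intro ball_cong[OF refl] si_unit_mem_atom_flat[OF p _ K]) blast
      also have "\<dots> \<longleftrightarrow> F \<sqsubseteq>\<^bsub>L_obj M\<^esub> K" unfolding le_L[OF M] by blast
      finally show "fn (si_unit M) ` fset F \<subseteq> atom_flat (L_obj M) K \<longleftrightarrow> F \<sqsubseteq>\<^bsub>L_obj M\<^esub> K" .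
    qed
    then have "fn (counit (L_obj M)) (fn (L_mor (si_unit M)) F) = F" by (rule counit_apply[OF G F])
    then show "fn (counit (L_obj M) \<odot>\<^bsub>GLat\<^esub> L_mor (si_unit M)) F = fn (Ide GLat (L_obj M)) F"
      by (simp add: GLat_cmp_apply[OF Lu F] GLat_ide_apply[OF F])
  qed
qed

theorem adjunction_L_S:
  "adjunction (Matr :: ('a matr, 'a matr_arrow) category) GLat L_functor S_functor si_unit counit"
proof (intro adjunction.intro adjunction_axioms.intro nat_trans.intro nat_trans_axioms.intro
    is_functor_L is_functor_S is_functor_id category_Matr category_GLat is_functor_comp,
    unfold comp_fctr_def id_fctr_def fctr.simps L_functor_simps S_functor_simps Obj_Matr Obj_GLat
    mem_Collect_eq)
qed (fact is_functor_L is_functor_S si_unit_hom si_unit_natural counit_hom counit_natural triangle_L triangle_S)+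

section \<open>Simplifications and simple matroids\<close>

lemma Matr_invertible:
  assumes f: "f \<in> hom_set Matr M N" and bij: "bij_betw (fn f) (ground M) (ground N)"
    and fl: "\<And>F. F \<in> flats M \<Longrightarrow> fn f ` F \<in> flats N"
  shows "\<exists>h \<in> hom_set Matr N M. h \<odot>\<^bsub>Matr\<^esub> f = Ide Matr M \<and> f \<odot>\<^bsub>Matr\<^esub> h = Ide Matr N"
proof -
  define h where "h = Arrow N (\<lambda>y\<in>ground N. inv_into (ground M) (fn f) y) M"
  have pM: "is_pointed_matroid M" and pN: "is_pointed_matroid N" using f by (simp_all add: Matr_hom)
  have inj: "inj_on (fn f) (ground M)" and surj: "fn f ` ground M = ground N"
    using bij by (simp_all add: bij_betw_def)
  have h_f: "fn h (fn f x) = x" if "x \<in> ground M" for x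
  proof -
    have "fn f x \<in> ground N" using that surj by blast
    then show ?thesis by (simp add: h_def inv_into_f_f[OF inj that])
  qed
  have f_h: "fn f (fn h y) = y" "fn h y \<in> ground M" if y: "y \<in> ground N" for y
  proof -
    obtain x where x: "x \<in> ground M" "y = fn f x" using y surj by blast
    show "fn f (fn h y) = y" "fn h y \<in> ground M" unfolding x(2) h_f[OF x(1)] using x(1) by auto
  qed
  have "strong_map N M (fn h)"
    unfolding strong_map_def
  proof (intro conjI ballI)
    show "fn h ` ground N \<subseteq> ground M" using f_h(2) by blast
    fix F assume F: "F \<in> flats M"
    have sub: "F \<subseteq> ground M" by (rule flats_subset[OF matroid_of_pointed[OF pM] F])
    have "{y \<in> ground N. fn h y \<in> F} = fn f ` F"
    proof (intro equalityI subsetI)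
      fix y assume "y \<in> {y \<in> ground N. fn h y \<in> F}"
      then show "y \<in> fn f ` F" using f_h(1)[of y] by (intro image_eqI[of _ _ "fn h y"]) auto
    next
      fix y assume "y \<in> fn f ` F"
      then obtain x where "x \<in> F" "y = fn f x" by blast
      then show "y \<in> {y \<in> ground N. fn h y \<in> F}" using sub h_f[of x] surj by auto
    qed
    then show "{y \<in> ground N. fn h y \<in> F} \<in> flats N" using fl[OF F] by simp
  qed
  moreover have "fn h (point N) = point M"
    using h_f[of "point M"] Matr_homD(5)[OF f] point_loop[OF pM] by (simp add: loop_def)
  moreover have "fn h \<in> ground N \<rightarrow>\<^sub>E ground M"
  proof
    show "fn h y \<in> ground M" if "y \<in> ground N" for y by (rule f_h(2)[OF that])
    show "fn h y = undefined" if "y \<notin> ground N" for y using that by (simp add: h_def)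
  qed
  moreover have "source h = N" "target h = M" by (simp_all add: h_def)
  ultimately have h: "h \<in> hom_set Matr N M"
    using pM pN by (simp add: Matr_hom)
  have "h \<odot>\<^bsub>Matr\<^esub> f = Ide Matr M"
    by (rule Matr_eqI[OF Matr_cmp_hom[OF f h] Matr_ide_hom[OF pM]])
      (simp add: Matr_cmp_apply[OF f] h_f Matr_ide_apply)
  moreover have "f \<odot>\<^bsub>Matr\<^esub> h = Ide Matr N"
    by (rule Matr_eqI[OF Matr_cmp_hom[OF h f] Matr_ide_hom[OF pN]])
      (simp add: Matr_cmp_apply[OF h] f_h Matr_ide_apply)
  ultimately show ?thesis using h by blast
qed

definition simplifying_set :: "'e pmatroid \<Rightarrow> 'e set \<Rightarrow> bool" where
  "simplifying_set M D \<longleftrightarrow> D \<subseteq> ground M - {point M} \<and>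
     (\<forall>x. loop M x \<and> x \<noteq> point M \<longrightarrow> x \<in> D) \<and>
     (\<forall>F. rank1_flat M F \<longrightarrow> (\<exists>!x. x \<in> F \<and> nonloop M x \<and> x \<notin> D))"

lemma simplification_of_iff: "simplification_of N M \<longleftrightarrow> (\<exists>D. simplifying_set M D \<and> N = delete M D)"
  by (auto simp: simplification_of_def simplifying_set_def)

text \<open>Keep the point and one chosen nonloop from each flat of rank 1.\<close>

lemma simplifying_set_exists:
  assumes p: "is_pointed_matroid M" shows "\<exists>D. simplifying_set M D"
proof -
  note M = matroid_of_pointed[OF p]
  define r where "r F = (SOME x. nonloop M x \<and> cl M {x} = F)" for F
  have r: "nonloop M (r (cl M {x}))" "cl M {r (cl M {x})} = cl M {x}" if "nonloop M x" for x
  proof -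
    have "\<exists>y. nonloop M y \<and> cl M {y} = cl M {x}" using that by blast
    from someI_ex[OF this] show "nonloop M (r (cl M {x}))" "cl M {r (cl M {x})} = cl M {x}"
      unfolding r_def by blast+
  qed
  define D where "D = {x \<in> ground M - {point M}. loop M x \<or> x \<noteq> r (cl M {x})}"
  have "\<exists>!x. x \<in> F \<and> nonloop M x \<and> x \<notin> D" if F: "rank1_flat M F" for F
  proof -
    from F obtain x where x: "nonloop M x" "F = cl M {x}" by (auto simp: rank1_flat_iff[OF M])
    show ?thesis
    proof (rule ex1I[of _ "r F"])
      show "r F \<in> F \<and> nonloop M (r F) \<and> r F \<notin> D"
        using r[OF x(1)] cl_superset[OF M, of "{r F}"] x(2) by (auto simp: D_def nonloop_def)
    next
      fix y assume y: "y \<in> F \<and> nonloop M y \<and> y \<notin> D"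
      then have "cl M {y} = F" using cl_nonloop_eq[OF M x(1)] x(2) by simp
      then show "y = r F" using y point_loop[OF p] by (auto simp: D_def nonloop_def)
    qed
  qed
  then have "simplifying_set M D" by (auto simp: simplifying_set_def D_def loop_def)
  then show ?thesis by blast
qed

text \<open>The unit sends nonloops to the same atom iff they span the same flat of rank 1, and of each such
  flat exactly one nonloop is kept; of the loops, only the point is kept.\<close>

lemma si_unit_bij_betw:
  assumes p: "is_pointed_matroid M" and D: "simplifying_set M D"
  shows "bij_betw (fn (si_unit M)) (ground M - D) (ground (S_obj (L_obj M)))"
proof -
  note M = matroid_of_pointed[OF p]
  have keep: "x = point M" if "loop M x" "x \<notin> D" for x
    using D that by (auto simp: simplifying_set_def)
  have pt: "point M \<notin> D" "point M \<in> ground M"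
    using D point_loop[OF p] by (auto simp: simplifying_set_def loop_def)
  have uniq: "\<exists>!y. y \<in> cl M {x} \<and> nonloop M y \<and> y \<notin> D" if "nonloop M x" for x
    using D that by (auto simp: simplifying_set_def rank1_flat_iff[OF M])
  have cases: "x = point M \<or> nonloop M x" if "x \<in> ground M - D" for x
    using keep that by (auto simp: nonloop_def)
  have u_pt: "fn (si_unit M) (point M) = Bullet" by (rule si_unit_loop[OF p point_loop[OF p]])
  have "x = y"
    if x: "x \<in> ground M - D" and y: "y \<in> ground M - D" and e: "fn (si_unit M) x = fn (si_unit M) y" for x y
  proof (cases "nonloop M x \<and> nonloop M y")
    case True
    then have "fset (Abs_fset (cl M {x})) = fset (Abs_fset (cl M {y}))"
      using e by (simp add: si_unit_nonloop[OF p])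
    then have "cl M {x} = cl M {y}" using x y by (simp add: fset_cl_point[OF p])
    then have "x \<in> cl M {x}" "y \<in> cl M {x}" using cl_superset[OF M] by blast+
    then show ?thesis using uniq[of x] True x y by blast
  next
    case False
    then show ?thesis using cases[OF x] cases[OF y] e u_pt by (auto simp: si_unit_nonloop[OF p])
  qed
  then have "inj_on (fn (si_unit M)) (ground M - D)" by (rule inj_onI)
  moreover have "fn (si_unit M) ` (ground M - D) = ground (S_obj (L_obj M))"
  proof (intro equalityI subsetI)
    fix e assume "e \<in> fn (si_unit M) ` (ground M - D)"
    then show "e \<in> ground (S_obj (L_obj M))" using si_unit_ground[OF p] by blast
  next
    fix e assume e: "e \<in> ground (S_obj (L_obj M))"
    show "e \<in> fn (si_unit M) ` (ground M - D)"
    proof (cases "e = Bullet")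
      case True
      then show ?thesis using u_pt pt by (intro image_eqI[of _ _ "point M"]) auto
    next
      case False
      then obtain F where F: "e = Elem F" "F \<in> atoms (L_obj M)" using e by (auto simp: ground_S)
      then obtain x where x: "nonloop M x" "fset F = cl M {x}" by (auto simp: L_atoms[OF M])
      obtain y where y: "y \<in> cl M {x}" "nonloop M y" "y \<notin> D" using uniq[OF x(1)] by blast
      then have "cl M {y} = fset F" using cl_nonloop_eq[OF M x(1)] x(2) by simp
      then have "fn (si_unit M) y = e" using F by (simp add: si_unit_nonloop[OF p y(2)] fset_inverse)
      then show ?thesis using y by (intro image_eqI[of _ _ y]) (auto simp: nonloop_def)
    qed
  qed
  ultimately show ?thesis by (simp add: bij_betw_def)
qed

text \<open>The unit pulls back the flat of atoms below \<open>F\<close> to \<open>F\<close>, and restricting it to the complement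
  of \<open>D\<close> cuts this down to \<open>F - D\<close>. Hence the deletion inherits the matroid axioms from the matroid
  of atoms.\<close>

lemma delete_pullback:
  assumes p: "is_pointed_matroid M"
  shows "flats (delete M D) =
    (\<lambda>F. {x \<in> ground (delete M D). fn (si_unit M) x \<in> F}) ` flats (S_obj (L_obj M))"
proof -
  note M = matroid_of_pointed[OF p]
  have pre: "{x \<in> ground M - D. fn (si_unit M) x \<in> atom_flat (L_obj M) F} = fset F - D"
    if F: "F \<in> carrier (L_obj M)" for F
    using carrier_L_ground[OF M F] si_unit_mem_atom_flat[OF p _ F] by blast
  have "flats (delete M D) = (\<lambda>F. fset F - D) ` carrier (L_obj M)"
  proof (intro equalityI subsetI)
    fix K assume "K \<in> flats (delete M D)"
    then obtain F where "F \<in> flats M" "K = F - D" by (auto simp: delete_def)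
    then show "K \<in> (\<lambda>F. fset F - D) ` carrier (L_obj M)"
      by (intro image_eqI[of _ _ "Abs_fset F"]) (simp_all add: fset_flat[OF M] carrier_L[OF M])
  next
    fix K assume "K \<in> (\<lambda>F. fset F - D) ` carrier (L_obj M)"
    then obtain F where "F \<in> carrier (L_obj M)" "K = fset F - D" by blast
    then show "K \<in> flats (delete M D)" unfolding carrier_L[OF M] by (auto simp: delete_def)
  qed
  also have "\<dots> = (\<lambda>F. {x \<in> ground M - D. fn (si_unit M) x \<in> atom_flat (L_obj M) F}) ` carrier (L_obj M)"
    by (rule image_cong[OF refl]) (simp only: pre)
  finally show ?thesis by (simp add: flats_S image_image delete_def)
qed

lemma simplification_pointed:
  fixes M :: "'a matr"
  assumes p: "is_pointed_matroid M" and D: "simplifying_set M D"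
  shows "is_pointed_matroid (delete M D)"
proof -
  have m: "is_matroid (delete M D)"
  proof (rule is_matroid_pullback[OF S_is_matroid[OF L_geometric[OF matroid_of_pointed[OF p]]]])
    show "finite (ground (delete M D))" using finite_ground[OF matroid_of_pointed[OF p]] by (simp add: delete_def)
    show "fn (si_unit M) ` ground (delete M D) = ground (S_obj (L_obj M))"
      using si_unit_bij_betw[OF p D] by (simp add: delete_def bij_betw_def)
  qed (rule delete_pullback[OF p])
  moreover have "loop (delete M D) (point M)"
    using point_loop[OF p] D by (auto simp: delete_def loop_def simplifying_set_def)
  ultimately show ?thesis by (simp add: is_pointed_matroid_def delete_def)
qed

lemma restricted_unit_invertible:
  assumes p: "is_pointed_matroid M" and D: "simplifying_set M D"
  defines "u \<equiv> Arrow (delete M D) (restrict (fn (si_unit M)) (ground M - D)) (S_obj (L_obj M))"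
  shows "u \<in> hom_set Matr (delete M D) (S_obj (L_obj M))"
    and "\<exists>h \<in> hom_set Matr (S_obj (L_obj M)) (delete M D).
      h \<odot>\<^bsub>Matr\<^esub> u = Ide Matr (delete M D) \<and> u \<odot>\<^bsub>Matr\<^esub> h = Ide Matr (S_obj (L_obj M))"
proof -
  let ?N = "delete M D" and ?S = "S_obj (L_obj M)"
  note bij = si_unit_bij_betw[OF p D] and pN = simplification_pointed[OF p D]
  have gN: "ground ?N = ground M - D" by (simp add: delete_def)
  have S: "is_matroid ?S" "is_pointed_matroid ?S"
    using S_is_matroid S_is_pointed L_geometric[OF matroid_of_pointed[OF p]] by blast+
  have fu: "fn u x = fn (si_unit M) x" if "x \<in> ground ?N" for x using that by (simp add: u_def gN)
  have bij_u: "bij_betw (fn u) (ground ?N) (ground ?S)"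
    using bij bij_betw_cong[of "ground ?N" "fn u" "fn (si_unit M)"] fu gN by simp
  have fl: "flats ?N = (\<lambda>F. {x \<in> ground ?N. fn u x \<in> F}) ` flats ?S"
    unfolding delete_pullback[OF p] using fu by (intro image_cong[OF refl] Collect_cong) auto
  have "strong_map ?N ?S (fn u)"
    unfolding strong_map_def using bij_u fl by (simp add: bij_betw_def)
  moreover have "fn u (point M) = Bullet"
    using fu[of "point M"] pN si_unit_loop[OF p point_loop[OF p]]
    by (simp add: is_pointed_matroid_def loop_def) (simp add: delete_def)
  moreover have "fn u \<in> ground ?N \<rightarrow>\<^sub>E ground ?S"
    using bij_u gN by (auto simp: u_def bij_betw_def)
  moreover have "point ?N = point M" by (simp add: delete_def)
  ultimately show u: "u \<in> hom_set Matr ?N ?S"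
    using pN S(2) by (simp add: Matr_hom u_def point_S)
  have "fn u ` F \<in> flats ?S" if "F \<in> flats ?N" for F
  proof -
    from that obtain K where K: "K \<in> flats ?S" "F = {x \<in> ground ?N. fn u x \<in> K}" unfolding fl by blast
    have "K \<subseteq> fn u ` ground ?N" using flats_subset[OF S(1) K(1)] bij_u by (simp add: bij_betw_def)
    then have "fn u ` F = K" unfolding K(2) by blast
    then show ?thesis using K(1) by simp
  qed
  then show "\<exists>h \<in> hom_set Matr ?S ?N. h \<odot>\<^bsub>Matr\<^esub> u = Ide Matr ?N \<and> u \<odot>\<^bsub>Matr\<^esub> h = Ide Matr ?S"
    by (rule Matr_invertible[OF u bij_u])
qed

lemma simplification_isomorphic:
  assumes "is_pointed_matroid M" "simplification_of N M"
  shows "isomorphic_in Matr N (S_obj (L_obj M))"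
proof -
  from assms(2) obtain D where D: "simplifying_set M D" "N = delete M D"
    by (auto simp: simplification_of_iff)
  note u = restricted_unit_invertible[OF assms(1) D(1)]
  show ?thesis
    unfolding isomorphic_in_def D(2) using u by (auto simp: Obj_Matr Matr_hom)
qed

text \<open>A simple pointed matroid is its own simplification, with nothing to delete.\<close>

lemma simple_unit_invertible:
  assumes p: "is_pointed_matroid M" and s: "simple_pointed M"
  shows "\<exists>h \<in> hom_set Matr (S_obj (L_obj M)) M.
    h \<odot>\<^bsub>Matr\<^esub> si_unit M = Ide Matr M \<and> si_unit M \<odot>\<^bsub>Matr\<^esub> h = Ide Matr (S_obj (L_obj M))"
proof -
  note M = matroid_of_pointed[OF p]
  have D: "simplifying_set M {}"
    unfolding simplifying_set_def
  proof (intro conjI allI impI)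
    fix F assume "rank1_flat M F"
    then obtain x where x: "nonloop M x" "F = cl M {x}" by (auto simp: rank1_flat_iff[OF M])
    then have "y = x" if "y \<in> F" "nonloop M y" for y
      using cl_nonloop_eq[OF M x(1) that(2)] that s
      by (auto simp: simple_pointed_def parallel_iff[OF M])
    then show "\<exists>!y. y \<in> F \<and> nonloop M y \<and> y \<notin> {}"
      using x cl_superset[OF M, of "{x}"] by (intro ex1I[of _ x]) auto
  qed (use s in \<open>auto simp: simple_pointed_def\<close>)
  have "delete M {} = M" by (simp add: delete_def)
  moreover have "Arrow M (restrict (fn (si_unit M)) (ground M)) (S_obj (L_obj M)) = si_unit M"
    by (simp add: si_unit_def)
  ultimately show ?thesis using restricted_unit_invertible(2)[OF p D] by simp
qed

text \<open>The unit identifies all loops with the point, and parallel elements with each other; a left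
  inverse of the unit therefore forces simplicity.\<close>

lemma simple_of_unit_retraction:
  assumes p: "is_pointed_matroid M" and h: "h \<odot>\<^bsub>Matr\<^esub> si_unit M = Ide Matr M"
  shows "simple_pointed M"
proof -
  have hu: "fn h (fn (si_unit M) x) = x" if "x \<in> ground M" for x
    using Matr_cmp_apply[OF si_unit_hom[OF p] that, of h] by (simp add: h Matr_ide_apply[OF that])
  have "x = point M" if "loop M x" for x
  proof -
    have g: "x \<in> ground M" "point M \<in> ground M" using that point_loop[OF p] by (simp_all add: loop_def)
    have "fn h Bullet = x" "fn h Bullet = point M"
      using hu[OF g(1)] hu[OF g(2)] unfolding si_unit_loop[OF p that] si_unit_loop[OF p point_loop[OF p]] .
    then show ?thesis by simp
  qed
  moreover have "x = y" if "parallel M x y" for x y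
  proof -
    have xy: "nonloop M x" "nonloop M y" "cl M {x} = cl M {y}"
      using that by (auto simp: parallel_iff[OF matroid_of_pointed[OF p]])
    then have g: "x \<in> ground M" "y \<in> ground M" by (simp_all add: nonloop_def)
    have "fn (si_unit M) x = fn (si_unit M) y"
      unfolding si_unit_nonloop[OF p xy(1)] si_unit_nonloop[OF p xy(2)] xy(3) ..
    then show ?thesis using hu[OF g(1)] hu[OF g(2)] by metis
  qed
  ultimately show ?thesis unfolding simple_pointed_def by blast
qed

lemma si_obj: "on_obj si M = S_obj (L_obj M)"
  by (simp add: si_def comp_fctr_def L_functor_simps S_functor_simps)

theorem monad_si: "monad (Matr :: ('a matr, 'a matr_arrow) category) si si_unit si_mult"
  using adjunction.induced_monad[OF adjunction_L_S]
  unfolding si_def si_mult_def[abs_def] induced_mult_def[abs_def] .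

theorem EM_isomorphic_SMatr:
  "isomorphic_categories
     (EM_category (Matr :: ('a matr, 'a matr_arrow) category) si si_unit si_mult)
     (SMatr :: ('a matr, 'a matr_arrow) category)"
  unfolding SMatr_def
proof (rule monad.EM_isomorphic_full_subcategory[OF monad_si])
  fix M :: "'a matr" and h assume "EM_algebra Matr si si_unit si_mult (M, h)"
  then have "is_pointed_matroid M" "h \<odot>\<^bsub>Matr\<^esub> si_unit M = Ide Matr M"
    by (simp_all add: EM_algebra_def Obj_Matr)
  then show "simple_pointed M" by (rule simple_of_unit_retraction)
next
  fix M :: "'a matr" assume "M \<in> Obj Matr" "simple_pointed M"
  then show "\<exists>h \<in> hom_set Matr (on_obj si M) M.
      h \<odot>\<^bsub>Matr\<^esub> si_unit M = Ide Matr M \<and> si_unit M \<odot>\<^bsub>Matr\<^esub> h = Ide Matr (on_obj si M)"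
    using simple_unit_invertible[of M] by (simp add: Obj_Matr si_obj)
qed

theorem theorem7p12:
  shows "adjunction (Matr :: ('a matr, 'a matr_arrow) category) GLat
           L_functor S_functor si_unit counit \<and>
         monad (Matr :: ('a matr, 'a matr_arrow) category) si si_unit si_mult \<and>
         (\<forall>M \<in> Obj (Matr :: ('a matr, 'a matr_arrow) category).
            (\<exists>N. simplification_of N M) \<and>
            (\<forall>N. simplification_of N M \<longrightarrow> isomorphic_in Matr N (on_obj si M))) \<and>
         isomorphic_categories
           (EM_category (Matr :: ('a matr, 'a matr_arrow) category) si si_unit si_mult)
           (SMatr :: ('a matr, 'a matr_arrow) category)"
proof (intro conjI ballI allI impI adjunction_L_S monad_si EM_isomorphic_SMatr)
  fix M :: "'a matr" assume "M \<in> Obj Matr"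
  then have p: "is_pointed_matroid M" by (simp add: Obj_Matr)
  show "\<exists>N. simplification_of N M"
    using simplifying_set_exists[OF p] by (auto simp: simplification_of_iff)
  fix N assume "simplification_of N M"
  then show "isomorphic_in Matr N (on_obj si M)"
    using simplification_isomorphic[OF p] by (simp add: si_obj)
qed

end
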